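(* Let $r \geq 1$, and let $H$ be a transitive soluble subgroup of the symmetric group $S_r$ of degree $r$. Let $N$ be an elementary abelian group of order $2^{3r}$. Then $\mathrm{Hol}(N)$ contains a transitive subgroup $G$ such that $G \cong \mathrm{GL}_3(2) \wr H$, and $N$ contains no non-trivial proper $G$-admissible subgroup. In particular, $(G,N)$ is an irreducible solution (that is: $N$ is soluble, $G$ is an insoluble transitive subgroup of $\mathrm{Hol}(N)$, the stabiliser in $G$ of any element of $N$ is soluble, and $N$ has no non-trivial proper $G$-invariant normal subgroup).
   Context: The holomorph of a group $N$ is $\mathrm{Hol}(N)=N\rtimes \mathrm{Aut}(N)$, with elements written $(\alpha,\theta)$, $\alpha\in N$, $\theta\in\mathrm{Aut}(N)$, product $(\alpha,\theta)(\beta,\phi)=(\alpha\theta(\beta),\theta\phi)$, acting on $N$ by $(\alpha,\theta)\cdot\eta=\alpha\theta(\eta)$. A subgroup $G\leq\mathrm{Hol}(N)$ is transitive if it acts transitively on $N$. Each $g\in G$ is written $g=(\alpha_g,\theta_g)$. A subgroup $M$ of $N$ is $G$-admissible if $M_*=\{g\in G:\alpha_g\in M\}$ is a subgroup of $G$; it is $G$-invariant if $\theta_g(m)\in M$ for all $g\in G$, $m\in M$. $\mathrm{GL}_3(2)$ is the group of invertible $3\times 3$ matrices over $\mathbb{F}_2$, and $\mathrm{GL}_3(2)\wr H=\mathrm{GL}_3(2)^r\rtimes H$ is the wreath product, with $H\leq S_r$ permuting the $r$ factors. *)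

theory Defs
  imports "HOL-Algebra.Algebra" "HOL-Analysis.Cartesian_Space" "HOL-Library.Z2"
begin

definition elementary_abelian :: "nat \<Rightarrow> ('a, 'b) monoid_scheme \<Rightarrow> bool"
  where "elementary_abelian p N \<longleftrightarrow>
    Factorial_Ring.prime p \<and> comm_group N \<and> (\<forall>x\<in>carrier N. x [^]\<^bsub>N\<^esub> p = \<one>\<^bsub>N\<^esub>)"

(* The semidirect product of K by H, where H acts on K from the left through act. *)
definition semidirect ::
    "('k, 'c) monoid_scheme \<Rightarrow> ('h, 'd) monoid_scheme \<Rightarrow> ('h \<Rightarrow> 'k \<Rightarrow> 'k) \<Rightarrow> ('k \<times> 'h) monoid"
  where "semidirect K H act =
    \<lparr>carrier = carrier K \<times> carrier H,
     monoid.mult = (\<lambda>(a, s) (b, t). (a \<otimes>\<^bsub>K\<^esub> act s b, s \<otimes>\<^bsub>H\<^esub> t)),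
     one = (\<one>\<^bsub>K\<^esub>, \<one>\<^bsub>H\<^esub>)\<rparr>"

definition holomorph :: "('a, 'b) monoid_scheme \<Rightarrow> ('a \<times> ('a \<Rightarrow> 'a)) monoid"
  where "holomorph N = semidirect N (AutoGroup N) (\<lambda>\<theta>. \<theta>)"

(* The restriction to carrier N is needed because BijGroup consists of extensional functions. *)
definition hol_act :: "('a, 'b) monoid_scheme \<Rightarrow> 'a \<times> ('a \<Rightarrow> 'a) \<Rightarrow> 'a \<Rightarrow> 'a"
  where "hol_act N g = (\<lambda>\<eta>\<in>carrier N. fst g \<otimes>\<^bsub>N\<^esub> snd g \<eta>)"

abbreviation hol_subgroup ::
    "('a, 'b) monoid_scheme \<Rightarrow> ('a \<times> ('a \<Rightarrow> 'a)) set \<Rightarrow> ('a \<times> ('a \<Rightarrow> 'a)) monoid"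
  where "hol_subgroup N G \<equiv> (holomorph N)\<lparr>carrier := G\<rparr>"

definition transitive_hol_subgroup ::
    "('a, 'b) monoid_scheme \<Rightarrow> ('a \<times> ('a \<Rightarrow> 'a)) set \<Rightarrow> bool"
  where "transitive_hol_subgroup N G \<longleftrightarrow>
    subgroup G (holomorph N) \<and>
    transitive_action (hol_subgroup N G) (carrier N) (hol_act N)"

definition admissible ::
    "('a, 'b) monoid_scheme \<Rightarrow> ('a \<times> ('a \<Rightarrow> 'a)) set \<Rightarrow> 'a set \<Rightarrow> bool"
  where "admissible N G M \<longleftrightarrow>
    subgroup M N \<and> subgroup {g \<in> G. fst g \<in> M} (hol_subgroup N G)"

definition invariant ::
    "('a, 'b) monoid_scheme \<Rightarrow> ('a \<times> ('a \<Rightarrow> 'a)) set \<Rightarrow> 'a set \<Rightarrow> bool"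
  where "invariant N G M \<longleftrightarrow> subgroup M N \<and> (\<forall>g\<in>G. \<forall>m\<in>M. snd g m \<in> M)"

definition irreducible_solution ::
    "('a \<times> ('a \<Rightarrow> 'a)) set \<Rightarrow> ('a, 'b) monoid_scheme \<Rightarrow> bool"
  where "irreducible_solution G N \<longleftrightarrow>
    group N \<and> solvable N \<and>
    transitive_hol_subgroup N G \<and> \<not> solvable (hol_subgroup N G) \<and>
    (\<forall>\<eta>\<in>carrier N.
       solvable (hol_subgroup N (stabilizer (hol_subgroup N G) (hol_act N) \<eta>))) \<and>
    \<not> (\<exists>M. M \<lhd> N \<and> invariant N G M \<and> M \<noteq> {\<one>\<^bsub>N\<^esub>} \<and> M \<noteq> carrier N)"

definition GL :: "('k::field ^ 'n ^ 'n) monoid"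
  where "GL = \<lparr>carrier = {A. invertible A}, monoid.mult = (**), one = mat 1\<rparr>"

abbreviation GL32 :: "(bit ^ 3 ^ 3) monoid"
  where "GL32 \<equiv> GL"

(* H is a set of permutations of {1..r}.  A permutation h moves the i-th factor to position h i,
   so the i-th coordinate of the image of f is the one of f at the preimage of i; this makes the
   action a left action. *)
definition wreath ::
    "('k, 'c) monoid_scheme \<Rightarrow> nat \<Rightarrow> (nat \<Rightarrow> nat) set \<Rightarrow> ((nat \<Rightarrow> 'k) \<times> (nat \<Rightarrow> nat)) monoid"
  where "wreath K r H =
    semidirect (product_group {1..r} (\<lambda>_. K)) ((sym_group r)\<lparr>carrier := H\<rparr>)
      (\<lambda>h f. \<lambda>i\<in>{1..r}. f (Hilbert_Choice.inv h i))"

definition transitive_perm_group :: "nat \<Rightarrow> (nat \<Rightarrow> nat) set \<Rightarrow> bool"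
  where "transitive_perm_group r H \<longleftrightarrow>
    subgroup H (sym_group r) \<and> (\<forall>i\<in>{1..r}. \<forall>j\<in>{1..r}. \<exists>h\<in>H. h i = j)"

end

theory Submission
  imports Defs "HOL-Analysis.Determinants"
begin

text \<open>
  The group \<open>GL(3,2)\<close> has a surjective cocycle \<open>c\<close> with values in its natural module \<open>V\<close>. It comes from
  the action on the eight quadratic maps \<open>q\<close> from \<open>V\<close> to its dual whose polarisation is the cross
  product and which satisfy \<open>q(x)(x) = 1\<close> for \<open>x \<noteq> 0\<close>: two of them differ by an alternating
  map, hence by \<open>v \<times> _\<close> for a unique \<open>v\<close>, so they form a torsor under \<open>V\<close>. The zero set \<open>S\<close> of \<open>c\<close> is
  the stabiliser of one such map; it is the normaliser of a Singer cycle, of order 21, which is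
  metabelian and transitive on the nonzero vectors.

  Applying \<open>c\<close> in each coordinate gives a surjective cocycle of the wreath product on \<open>V\<^sup>r\<close>, and the
  pairs of cocycle value and linear action form the required subgroup \<open>G\<close> of the holomorph. The
  stabiliser of the identity in \<open>G\<close> is the soluble group \<open>S wr H\<close>. Both an admissible and an invariant
  subgroup \<open>M\<close> are invariant under this stabiliser. If \<open>M\<close> contains \<open>w\<close> with a nonzero coordinate \<open>i\<close>, then
  moving only that coordinate by \<open>S\<close> and subtracting gives an element of \<open>M\<close> supported at \<open>i\<close>, and
  the transitivity of \<open>S\<close> on nonzero vectors and of \<open>H\<close> on the coordinates yields \<open>M = V\<^sup>r\<close>.
\<close>

section \<open>A surjective cocycle on GL(3,2)\<close>

lemma bit_add_self [simp]: "x + x = (0::bit)"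
  by (cases x) auto

lemma bit_add_self_left [simp]: "x + (x + y) = (y::bit)"
  by (cases x; cases y) auto

lemma bit_mult_self [simp]: "x * x = (x::bit)"
  by (cases x) auto
lemma bit_mult_self_left [simp]: "x * (x * y) = (x * y::bit)"
  by (cases x) auto

lemma vec_add_self [simp]: "v + v = (0::bit^'n)"
  by (simp add: vec_eq_iff del: add_bit_eq_xor)

lemma vec_add_self_left [simp]: "v + (v + w) = (w::bit^'n)"
  by (simp add: vec_eq_iff del: add_bit_eq_xor)

text \<open>To be read as an element of the dual space: it is the functional sending
  \<open>x\<close> to the determinant with columns \<open>v\<close>, \<open>w\<close>,
  \<open>x\<close>. Matrices therefore act on it from the right, by \<open>v*\<close>.\<close>

definition vcross :: "'a::comm_ring_1 ^ 3 \<Rightarrow> 'a ^ 3 \<Rightarrow> 'a ^ 3"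
  where "vcross v w = vector [v$2 * w$3 - v$3 * w$2, v$3 * w$1 - v$1 * w$3, v$1 * w$2 - v$2 * w$1]"

lemma vcross_nth [simp]:
  "vcross v w $ 1 = v$2 * w$3 - v$3 * w$2"
  "vcross v w $ 2 = v$3 * w$1 - v$1 * w$3"
  "vcross v w $ 3 = v$1 * w$2 - v$2 * w$1"
  by (simp_all add: vcross_def)

text \<open>Paired with \<open>x\<close>, this is the multiplicativity of the determinant applied to
  \<open>A *v v\<close>, \<open>A *v w\<close>, \<open>A *v x\<close>.\<close>

lemma vcross_mult_matrix:
  fixes A :: "'a::comm_ring_1 ^ 3 ^ 3"
  shows "vcross (A *v v) (A *v w) v* A = det A *s vcross v w"
  by (simp add: vec_eq_iff forall_3 matrix_vector_mult_def vector_matrix_mult_def sum_3 det_3 algebra_simps)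

text \<open>In suitable coordinates \<open>quad\<close> is the map \<open>x \<mapsto> x\<^sup>6\<close> of the field with eight elements,
  with values in the dual space. Its polarisation is the cross product, and \<open>x \<bullet> quad x = 1\<close> for
  \<open>x \<noteq> 0\<close>; the maps with these two properties are exactly the eight maps \<open>quad + v \<times> _\<close>.\<close>

definition quad :: "bit^3 \<Rightarrow> bit^3"
  where "quad x = vector [x$2 * x$3 + x$1 + x$2, x$1 * x$3 + x$2 + x$3, x$1 * x$2 + x$3 + x$1]"

lemma quad_nth [simp]:
  "quad x $ 1 = x$2 * x$3 + x$1 + x$2"
  "quad x $ 2 = x$1 * x$3 + x$2 + x$3"
  "quad x $ 3 = x$1 * x$2 + x$3 + x$1"
  by (simp_all add: quad_def)

lemma quad_add: "quad (x + y) = quad x + quad y + vcross x y"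
  by (simp add: vec_eq_iff forall_3 algebra_simps del: add_bit_eq_xor mult_bit_eq_and)

lemma vec3_eq_0_iff: "x = 0 \<longleftrightarrow> x$1 = 0 \<and> x$2 = 0 \<and> x$3 = 0" for x :: "'a::zero^3"
  by (simp add: vec_eq_iff forall_3)

text \<open>As a polynomial function the sum is
  \<open>1 + (1 + x$1) * (1 + x$2) * (1 + x$3)\<close>, which vanishes only at the origin.\<close>

lemma sum_mult_quad: "(\<Sum>i\<in>UNIV. x$i * quad x$i) = of_bool (x \<noteq> 0)"
  by (cases "x$1"; cases "x$2"; cases "x$3") (simp_all add: sum_3 vec3_eq_0_iff)

text \<open>The alternating condition at the basis vectors clears the diagonal of the matrix of
  \<open>L\<close>, and at sums of two of them it makes the matrix symmetric. In dimension 3 this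
  leaves three free entries, as many as \<open>v\<close> has.\<close>

lemma alternating_is_vcross:
  fixes L :: "bit^3 \<Rightarrow> bit^3"
  assumes add: "\<And>x y. L (x + y) = L x + L y" and alt: "\<And>x. (\<Sum>i\<in>UNIV. x$i * L x$i) = 0"
  shows "\<exists>v. \<forall>x. L x = vcross v x"
proof -
  have z: "L 0 = 0" using add[of 0 0] by simp
  let ?e1 = "axis 1 1 :: bit^3"
  let ?e2 = "axis 2 1 :: bit^3"
  let ?e3 = "axis 3 1 :: bit^3"
  have dec: "x = x$1 *s ?e1 + x$2 *s ?e2 + x$3 *s ?e3" for x
    by (simp add: vec_eq_iff forall_3 axis_def)
  \<comment> \<open>The only scalars are 0 and 1, so additivity already gives linearity.\<close>
  have sc: "L (a *s x) = a *s L x" for a x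
    by (cases a) (simp_all add: z)
  have Lx: "L x = x$1 *s L ?e1 + x$2 *s L ?e2 + x$3 *s L ?e3" for x
    by (subst dec) (simp only: add sc)
  note a1 = alt[of ?e1] and a2 = alt[of ?e2] and a3 = alt[of ?e3]
   and a12 = alt[of "?e1 + ?e2"] and a13 = alt[of "?e1 + ?e3"] and a23 = alt[of "?e2 + ?e3"]
  \<comment> \<open>The entries of \<open>v\<close> are the third coordinate of
    \<open>vcross v e2\<close>, the first of \<open>vcross v e3\<close> and the second of
    \<open>vcross v e1\<close>.\<close>
  have "L x = vcross (vector [L ?e2 $ 3, L ?e3 $ 1, L ?e1 $ 2]) x" for x
  proof -
    have d: "L ?e1 $ 1 = 0" "L ?e2 $ 2 = 0" "L ?e3 $ 3 = 0"
      using a1 a2 a3 by (simp_all add: sum_3 axis_def)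
    have "L ?e1 $ 2 + L ?e2 $ 1 = 0" "L ?e1 $ 3 + L ?e3 $ 1 = 0" "L ?e2 $ 3 + L ?e3 $ 2 = 0"
      using a12 a13 a23 d by (simp_all add: add sum_3 axis_def ac_simps del: add_bit_eq_xor mult_bit_eq_and)
    then have e: "L ?e2 $ 1 = L ?e1 $ 2" "L ?e3 $ 1 = L ?e1 $ 3" "L ?e3 $ 2 = L ?e2 $ 3"
      by (metis bit_add_self_left add_0_right)+
    show ?thesis
      by (subst Lx)
        (simp add: vec_eq_iff forall_3 d e mult.commute del: add_bit_eq_xor mult_bit_eq_and)
  qed
  then show ?thesis by blast
qed

lemma vcross_left_cancel: "(\<forall>x. vcross v x = vcross w x) \<longleftrightarrow> v = w" for v w :: "bit^3"
proof
  assume a: "\<forall>x. vcross v x = vcross w x"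
  show "v = w"
    using a[rule_format, of "axis 1 1"] a[rule_format, of "axis 2 1"]
    by (simp add: vec_eq_iff forall_3 axis_def del: add_bit_eq_xor mult_bit_eq_and)
qed simp

lemma vcross_add_left: "vcross (v + w) x = vcross v x + vcross w x" for v :: "bit^3"
  by (simp add: vec_eq_iff forall_3 algebra_simps del: add_bit_eq_xor mult_bit_eq_and)

lemma vcross_mult_matrix_bit:
  fixes A :: "bit^3^3"
  assumes "invertible A"
  shows "vcross (A *v v) (A *v w) v* A = vcross v w"
proof -
  have "det A = 1" using assms by (simp add: invertible_det_nz)
  then show ?thesis by (simp add: vcross_mult_matrix)
qed

text \<open>\<open>A\<close> acts on such maps by transport of structure, dual space included; \<open>carries A v\<close> says that it
  sends \<open>quad\<close> to \<open>quad + v \<times> _\<close>.\<close>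

definition carries :: "bit^3^3 \<Rightarrow> bit^3 \<Rightarrow> bool"
  where "carries A v \<longleftrightarrow> (\<forall>x. (quad (A *v x) + vcross v (A *v x)) v* A = quad x)"

text \<open>\<open>v* A\<close> is the adjoint of \<open>A *v\<close> for the pairing between the
  space and its dual.\<close>

lemma sum_mult_vector_matrix:
  fixes A :: "'a::comm_semiring_1^'n^'m"
  shows "(\<Sum>i\<in>UNIV. x$i * (y v* A)$i) = (\<Sum>i\<in>UNIV. (A *v x)$i * y$i)"
  unfolding matrix_vector_mult_def vector_matrix_mult_def
  by (simp add: sum_distrib_left sum_distrib_right, subst sum.swap) (simp add: ac_simps)

lemma invertible_mult_vec_eq_0_iff:
  fixes A :: "'a::field^'n^'n"
  assumes "invertible A"
  shows "A *v x = 0 \<longleftrightarrow> x = 0"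
  by (metis assms invertible_def matrix_vector_mul_assoc matrix_vector_mul_lid matrix_vector_mult_0_right)

lemma invertible_vector_matrix_cancel:
  fixes A :: "'a::field^'n^'n"
  assumes "invertible A" "x v* A = y v* A"
  shows "x = y"
  by (metis assms invertible_def vector_matrix_mul_assoc vector_matrix_mul_rid)

text \<open>\<open>quad\<close> and its pullback along \<open>A\<close> have the same polarisation,
  since \<open>det A = 1\<close>, and the same pairing with \<open>x\<close>, since \<open>A\<close>
  preserves being nonzero. Their difference is therefore additive and alternating.\<close>

lemma carries_exists:
  assumes A: "invertible A"
  shows "\<exists>v. carries A v"
proof -
  let ?L = "\<lambda>x. quad x + quad (A *v x) v* A"
  have "\<exists>v. \<forall>x. ?L x = vcross v x"
  proof (rule alternating_is_vcross)
    fix x y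
    show "?L (x + y) = ?L x + ?L y"
      by (simp add: quad_add vector_matrix_left_distrib matrix_vector_right_distrib vcross_mult_matrix_bit[OF A] ac_simps)
  next
    fix x
    show "(\<Sum>i\<in>UNIV. x$i * ?L x$i) = 0"
      by (simp add: distrib_left sum.distrib sum_mult_quad sum_mult_vector_matrix
          invertible_mult_vec_eq_0_iff[OF A] del: add_bit_eq_xor mult_bit_eq_and)
  qed
  then obtain v where v: "?L x = vcross v x" for x by blast
  \<comment> \<open>\<open>v\<close> describes the difference before \<open>A\<close> is applied;
    \<open>carries\<close> measures it afterwards, hence the witness \<open>A *v v\<close>.\<close>
  have "(quad (A *v x) + vcross (A *v v) (A *v x)) v* A = quad x" for x
    by (simp add: vector_matrix_left_distrib vcross_mult_matrix_bit[OF A] v[symmetric] ac_simps)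
  then show ?thesis unfolding carries_def by blast
qed

text \<open>\<open>B\<close> takes \<open>quad\<close> to its translate by \<open>w\<close>;
  applying \<open>A\<close> translates \<open>quad\<close> by \<open>v\<close> and turns the
  translation by \<open>w\<close> into one by \<open>A *v w\<close>.\<close>

lemma carries_mult:
  assumes "invertible A" "carries A v" "carries B w"
  shows "carries (A ** B) (v + A *v w)"
proof -
  have "(quad (A ** B *v x) + vcross (v + A *v w) (A ** B *v x)) v* (A ** B) = quad x" for x
  proof -
    have "(quad (A ** B *v x) + vcross (v + A *v w) (A ** B *v x)) v* (A ** B)
      = ((quad (A *v (B *v x)) + vcross v (A *v (B *v x))) v* A
          + vcross (A *v w) (A *v (B *v x)) v* A) v* B"
      by (simp add: vector_matrix_mul_assoc[symmetric] matrix_vector_mul_assoc[symmetric] vcross_add_left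
         vector_matrix_left_distrib ac_simps)
    also have "\<dots> = quad x"
      using assms by (simp add: carries_def vcross_mult_matrix_bit)
    finally show ?thesis .
  qed
  then show ?thesis by (simp add: carries_def)
qed

text \<open>Invertibility lets \<open>v* A\<close> be cancelled and makes every vector a value of
  \<open>A *v\<close>, so the two cross products agree everywhere.\<close>

lemma carries_unique:
  assumes A: "invertible A" and "carries A v" "carries A w"
  shows "v = w"
proof -
  from A obtain B where B: "A ** B = mat 1" by (auto simp: invertible_def)
  have "vcross v x = vcross w x" for x
  proof -
    have "x = A *v (B *v x)" by (simp add: matrix_vector_mul_assoc B)
    moreover have "(quad (A *v y) + vcross v (A *v y)) v* A
      = (quad (A *v y) + vcross w (A *v y)) v* A" for y
      using assms by (simp add: carries_def)
    ultimately show ?thesis using invertible_vector_matrix_cancel[OF A] by (metis add_left_cancel)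
  qed
  then show ?thesis using vcross_left_cancel by blast
qed

text \<open>Meaningful for invertible \<open>A\<close> only, where \<open>carries_exists\<close> and
  \<open>carries_unique\<close> justify the description.\<close>

definition gl_coc :: "bit^3^3 \<Rightarrow> bit^3"
  where "gl_coc A = (THE v. carries A v)"

lemma gl_coc_eqI: "invertible A \<Longrightarrow> carries A v \<Longrightarrow> gl_coc A = v"
  unfolding gl_coc_def by (blast intro: carries_unique)

lemma carries_gl_coc: "invertible A \<Longrightarrow> carries A (gl_coc A)"
  using carries_exists gl_coc_eqI by metis

lemma gl_coc_mult:
  assumes "invertible A" "invertible B"
  shows "gl_coc (A ** B) = gl_coc A + A *v gl_coc B"
  using assms by (intro gl_coc_eqI invertible_mult carries_mult carries_gl_coc)

lemma gl_coc_one: "gl_coc (mat 1) = 0"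
  using gl_coc_mult[of "mat 1" "mat 1"]
  by (simp add: invertible_def)

lemma invertible_iff_det_bit: "invertible A \<longleftrightarrow> det A = 1" for A :: "bit^'n^'n"
  by (simp add: invertible_det_nz)

text \<open>The witnesses form the group of unitriangular matrices: a Sylow 2-subgroup acts regularly on the
  eight maps, because the stabiliser of \<open>quad\<close> has odd order 21.\<close>

lemma gl_coc_surj: "\<exists>A. invertible A \<and> gl_coc A = v"
proof -
  define A :: "bit^3^3" where "A = vector [vector [1, v$3, v$2 + v$1 * v$3],
    vector [0, 1, v$1 + v$2 + v$2 * v$3], vector [0, 0, 1]]"
  have "invertible A"
    by (simp add: invertible_iff_det_bit A_def det_3)
  moreover have "carries A v"
    unfolding carries_def
    by (simp add: A_def vec_eq_iff forall_3 matrix_vector_mult_def vector_matrix_mult_def sum_3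
        algebra_simps del: add_bit_eq_xor mult_bit_eq_and)
  ultimately show ?thesis using gl_coc_eqI by blast
qed

lemma vcross_zero_left: "vcross 0 x = 0"
  by (simp add: vec_eq_iff forall_3)

section \<open>The kernel of the cocycle\<close>

lemma GL_simps [simp]:
  "carrier GL = {A. invertible A}" "monoid.mult GL = (**)" "one GL = mat 1"
  by (simp_all add: GL_def)

lemma group_GL: "group GL"
proof (rule groupI; simp add: invertible_mult matrix_mul_assoc)
  show "invertible (mat 1 :: 'a^'b^'b)" by (auto simp: invertible_def intro!: exI[of _ "mat 1"])
  show "\<exists>B. invertible B \<and> B ** A = mat 1" if "invertible A" for A :: "'a^'b^'b"
    using that unfolding invertible_def by metis
qed

interpretation GL: group GL
  by (rule group_GL)

text \<open>Not the kernel of a homomorphism: the zero set of a cocycle is a point stabiliser of the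
  affine action, here that of \<open>quad\<close>.\<close>

definition coc_kernel :: "(bit^3^3) set"
  where "coc_kernel = {A. invertible A \<and> gl_coc A = 0}"

text \<open>Turns membership into polynomial equations that can be tested on explicit
  matrices.\<close>

lemma coc_kernel_iff: "A \<in> coc_kernel \<longleftrightarrow> invertible A \<and> (\<forall>x. quad (A *v x) v* A = quad x)"
proof -
  have "gl_coc A = 0 \<longleftrightarrow> carries A 0" if "invertible A"
    using that gl_coc_eqI carries_gl_coc by metis
  moreover have "carries A 0 \<longleftrightarrow> (\<forall>x. quad (A *v x) v* A = quad x)"
    by (simp add: carries_def vcross_zero_left)
  ultimately show ?thesis by (auto simp: coc_kernel_def)
qed

lemma subgroup_coc_kernel: "subgroup coc_kernel GL32"
proof (rule GL.subgroupI)
  show "coc_kernel \<noteq> {}" using gl_coc_one by (auto simp: coc_kernel_def invertible_def intro!: exI[of _ "mat 1"])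
  show "A \<otimes>\<^bsub>GL32\<^esub> B \<in> coc_kernel" if "A \<in> coc_kernel" "B \<in> coc_kernel" for A B
    using that by (simp add: coc_kernel_def gl_coc_mult invertible_mult)
  show "inv\<^bsub>GL32\<^esub> A \<in> coc_kernel" if "A \<in> coc_kernel" for A
  proof -
    have A: "A \<in> carrier GL32" using that by (simp add: coc_kernel_def)
    then have i: "invertible (inv\<^bsub>GL32\<^esub> A)" using GL.inv_closed by auto
    have "A ** inv\<^bsub>GL32\<^esub> A = mat 1" using GL.r_inv[OF A] by simp
    \<comment> \<open>The cocycle identity for the product of \<open>A\<close> and its inverse, with
      \<open>gl_coc A = 0\<close>.\<close>
    then have "A *v gl_coc (inv\<^bsub>GL32\<^esub> A) = 0"
      using that i gl_coc_mult[of A "inv\<^bsub>GL32\<^esub> A"] by (simp add: coc_kernel_def gl_coc_one)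
    then have "gl_coc (inv\<^bsub>GL32\<^esub> A) = 0"
      using that by (simp add: coc_kernel_def invertible_mult_vec_eq_0_iff)
    with i show ?thesis by (simp add: coc_kernel_def)
  qed
qed (auto simp: coc_kernel_def)

text \<open>\<open>singer\<close> has order 7, \<open>singer_alg v\<close> is the element of the field generated by it with first
  column \<open>v\<close>, and \<open>frob\<close> induces the Frobenius automorphism on that field.\<close>

definition singer :: "bit^3^3"
  where "singer = vector [vector [0, 0, 1], vector [0, 1, 1], vector [1, 1, 0]]"

definition singer_alg :: "bit^3 \<Rightarrow> bit^3^3"
  where "singer_alg v = vector [vector [v$1, v$2, v$3], vector [v$2, v$1 + v$2 + v$3, v$2 + v$3],
     vector [v$3, v$2 + v$3, v$1 + v$2]]"

definition frob :: "bit^3^3"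
  where "frob = vector [vector [1, 1, 1], vector [0, 1, 1], vector [0, 1, 0]]"

lemmas mat_simps = vec_eq_iff forall_3 matrix_vector_mult_def vector_matrix_mult_def
  matrix_matrix_mult_def sum_3 mat_def

lemma singer_alg_axis: "singer_alg v *v axis 1 1 = v"
  by (simp add: singer_alg_def axis_def mat_simps)

lemma singer_alg_comm: "singer_alg v ** singer_alg w = singer_alg w ** singer_alg v"
  by (simp add: singer_alg_def mat_simps algebra_simps del: add_bit_eq_xor mult_bit_eq_and)

lemma singer_eq: "singer = singer_alg (axis 3 1)"
  by (simp add: singer_def singer_alg_def axis_def vec_eq_iff forall_3)

text \<open>In the field picture \<open>quad\<close> is inversion up to a constant factor, and the
  symmetric matrix \<open>singer_alg v\<close> is multiplication by \<open>v\<close>. Multiplying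
  the argument by \<open>v\<close> divides the value by \<open>v\<close>, and the adjoint multiplies
  it back. The proof checks the seven cases.\<close>

lemma singer_alg_in_coc_kernel:
  assumes "v \<noteq> 0"
  shows "singer_alg v \<in> coc_kernel"
proof -
  have "invertible (singer_alg v)"
    using assms unfolding invertible_iff_det_bit vec3_eq_0_iff
    by (cases "v$1"; cases "v$2"; cases "v$3"; simp add: det_3 singer_alg_def)
  moreover have "quad (singer_alg v *v x) v* singer_alg v = quad x" for x
    using assms unfolding vec3_eq_0_iff
    by (cases "v$1"; cases "v$2"; cases "v$3";
        simp add: singer_alg_def mat_simps algebra_simps del: add_bit_eq_xor mult_bit_eq_and)
  ultimately show ?thesis by (simp add: coc_kernel_iff)
qed

text \<open>Pass through the first basis vector, which \<open>singer_alg v\<close> sends to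
  \<open>v\<close> and \<open>singer_alg w\<close> to \<open>w\<close>.\<close>

lemma coc_kernel_transitive:
  assumes "v \<noteq> 0" "w \<noteq> 0"
  shows "\<exists>A\<in>coc_kernel. A *v v = w"
proof -
  interpret subgroup coc_kernel GL32 by (rule subgroup_coc_kernel)
  have s: "singer_alg v \<in> coc_kernel" "singer_alg w \<in> coc_kernel" using assms singer_alg_in_coc_kernel by auto
  let ?i = "inv\<^bsub>GL32\<^esub> (singer_alg v)"
  have "?i ** singer_alg v = mat 1" using GL.l_inv[of "singer_alg v"] s(1) by (simp add: coc_kernel_def)
  then have "?i *v v = axis 1 1"
    using singer_alg_axis by (metis matrix_vector_mul_assoc matrix_vector_mul_lid)
  then have "(singer_alg w ** ?i) *v v = w" by (simp add: matrix_vector_mul_assoc[symmetric] singer_alg_axis)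
  moreover have "singer_alg w ** ?i \<in> coc_kernel" using m_closed[OF s(2) m_inv_closed[OF s(1)]] by simp
  ultimately show ?thesis by blast
qed

text \<open>The first column of \<open>B\<close> is known, leaving 64 candidates for the other
  entries. Preserving \<open>quad\<close> at the three basis vectors and at the sum of the last two
  rules out all but the powers of \<open>frob\<close>.\<close>

lemma coc_kernel_fixing_axis:
  assumes "B \<in> coc_kernel" "B *v axis 1 1 = axis 1 1"
  shows "B = mat 1 \<or> B = frob \<or> B = frob ** frob"
proof -
  have c: "B$1$1 = 1" "B$2$1 = 0" "B$3$1 = 0"
    using assms(2) by (simp_all add: mat_simps axis_def)
  have q: "quad (B *v axis j 1) v* B = quad (axis j 1)" for j
    using assms(1) by (simp add: coc_kernel_iff)
  have q': "quad (B *v (axis 2 1 + axis 3 1)) v* B = quad (axis 2 1 + axis 3 1)"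
    using assms(1) by (simp add: coc_kernel_iff)
  have m: "B *v axis j 1 = column j B" for j
    by (simp add: vec_eq_iff matrix_vector_mult_def column_def axis_def if_distrib cong: if_cong)
  show ?thesis
    using q[of 1] q[of 2] q[of 3] q' c unfolding m matrix_vector_right_distrib
    by (simp add: mat_simps axis_def column_def frob_def)
      (cases "B$1$2"; cases "B$1$3"; cases "B$2$2"; cases "B$2$3"; cases "B$3$2"; cases "B$3$3";
       simp)
qed

text \<open>With \<open>v\<close> the first column of \<open>A\<close>, the product of the inverse
  of \<open>singer_alg v\<close> with \<open>A\<close> fixes the first basis vector.\<close>

lemma coc_kernel_cases:
  assumes "A \<in> coc_kernel"
  obtains v where "v \<noteq> 0" "A = singer_alg v \<or> A = singer_alg v ** frob \<or> A = singer_alg v ** (frob ** frob)"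
proof -
  interpret subgroup coc_kernel GL32 by (rule subgroup_coc_kernel)
  define v where "v = A *v axis 1 1"
  have A: "invertible A" using assms by (simp add: coc_kernel_def)
  have v: "v \<noteq> 0" unfolding v_def using A by (simp add: invertible_mult_vec_eq_0_iff)
  have f: "singer_alg v \<in> coc_kernel" using singer_alg_in_coc_kernel v .
  let ?i = "inv\<^bsub>GL32\<^esub> (singer_alg v)"
  have i: "?i ** singer_alg v = mat 1" "singer_alg v ** ?i = mat 1"
    using GL.l_inv[of "singer_alg v"] GL.r_inv[of "singer_alg v"] f by (simp_all add: coc_kernel_def)
  have "?i *v v = axis 1 1"
    using singer_alg_axis i by (metis matrix_vector_mul_assoc matrix_vector_mul_lid)
  then have "(?i ** A) *v axis 1 1 = axis 1 1" by (metis matrix_vector_mul_assoc v_def)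
  moreover have "?i ** A \<in> coc_kernel" using m_closed[OF m_inv_closed[OF f] assms] by simp
  ultimately have "?i ** A = mat 1 \<or> ?i ** A = frob \<or> ?i ** A = frob ** frob"
    using coc_kernel_fixing_axis by blast
  moreover have "A = singer_alg v ** (?i ** A)" by (simp add: matrix_mul_assoc i)
  ultimately have "A = singer_alg v \<or> A = singer_alg v ** frob \<or> A = singer_alg v ** (frob ** frob)"
    by (metis matrix_mul_rid)
  with v that show thesis by blast
qed

section \<open>The kernel of the cocycle is metabelian\<close>

lemma singer_powers:
  shows singer_pow_1: "singer [^]\<^bsub>GL32\<^esub> (1::nat) = singer"
    and singer_pow_2: "singer [^]\<^bsub>GL32\<^esub> (2::nat) = singer_alg (vector [1, 1, 0])"
    and singer_pow_4: "singer [^]\<^bsub>GL32\<^esub> (4::nat) = singer_alg (vector [0, 1, 1])"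
    and singer_pow_7: "singer [^]\<^bsub>GL32\<^esub> (7::nat) = mat 1"
proof -
  \<comment> \<open>Successively the powers 2, 4, 6 and 7 of \<open>singer\<close>, each but the
    last recorded by its first column.\<close>
  have 2: "singer ** singer = singer_alg (vector [1, 1, 0])"
    by (simp add: singer_def singer_alg_def mat_simps)
  have 4: "singer_alg (vector [1, 1, 0]) ** singer_alg (vector [1, 1, 0]) = singer_alg (vector [0, 1, 1])"
    by (simp add: singer_alg_def mat_simps)
  have 6: "singer_alg (vector [0, 1, 1]) ** singer_alg (vector [1, 1, 0]) = singer_alg (vector [1, 1, 1])"
    by (simp add: singer_alg_def mat_simps)
  have 7: "singer_alg (vector [1, 1, 1]) ** singer = mat 1"
    by (simp add: singer_def singer_alg_def mat_simps)
  show "singer [^]\<^bsub>GL32\<^esub> (1::nat) = singer" by simp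
  show "singer [^]\<^bsub>GL32\<^esub> (2::nat) = singer_alg (vector [1, 1, 0])"
    by (simp add: numeral_eq_Suc 2)
  have "singer [^]\<^bsub>GL32\<^esub> (4::nat) = (singer ** singer) ** (singer ** singer)"
    by (simp add: numeral_eq_Suc matrix_mul_assoc)
  also have "\<dots> = singer_alg (vector [0, 1, 1])" by (simp only: 2 4)
  finally show "singer [^]\<^bsub>GL32\<^esub> (4::nat) = singer_alg (vector [0, 1, 1])" .
  have "singer [^]\<^bsub>GL32\<^esub> (7::nat) = (singer ** singer) ** (singer ** singer) ** (singer ** singer) ** singer"
    by (simp add: numeral_eq_Suc matrix_mul_assoc)
  also have "\<dots> = mat 1" by (simp only: 2 4 6 7)
  finally show "singer [^]\<^bsub>GL32\<^esub> (7::nat) = mat 1" .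
qed

text \<open>Both \<open>x \<otimes> y\<close> and \<open>y \<otimes> x\<close> conjugate
  \<open>s\<close> to its power with exponent \<open>k * l\<close>, so the commutator commutes with
  that power. The number \<open>m\<close> inverts \<open>k * l\<close> modulo the order of
  \<open>s\<close>, which recovers \<open>s\<close> itself.\<close>

lemma (in group) commutator_centralizes:
  fixes k l m :: nat
  assumes "x \<in> carrier G" "y \<in> carrier G" and s: "s \<in> carrier G"
    and x: "x \<otimes> s = s [^] k \<otimes> x" and y: "y \<otimes> s = s [^] l \<otimes> y"
    and m: "s [^] (k * l * m) = s"
  shows "(x \<otimes> y \<otimes> inv x \<otimes> inv y) \<otimes> s = s \<otimes> (x \<otimes> y \<otimes> inv x \<otimes> inv y)"
proof -
  let ?c = "x \<otimes> y \<otimes> inv x \<otimes> inv y"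
  have pow: "z \<otimes> s [^] n = s [^] (i * n) \<otimes> z" if z: "z \<in> carrier G" "z \<otimes> s = s [^] i \<otimes> z" for z n and i :: nat
  proof (induction n)
    case (Suc n)
    have "z \<otimes> s [^] Suc n = s [^] (i * n) \<otimes> (z \<otimes> s)"
      using Suc z(1) s by (simp add: m_assoc[symmetric])
    also have "\<dots> = s [^] (i * Suc n) \<otimes> z"
      using z s by (simp add: m_assoc[symmetric] nat_pow_mult add.commute)
    finally show ?case .
  qed (use z in simp)
  have t: "s [^] (k * l) \<in> carrier G" using s by simp
  have xy: "x \<otimes> y \<otimes> s = s [^] (k * l) \<otimes> (x \<otimes> y)"
    using assms(1,2) s by (simp add: m_assoc y pow[OF assms(1) x]) (simp add: m_assoc[symmetric] pow[OF assms(1) x])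
  have yx: "y \<otimes> x \<otimes> s = s [^] (k * l) \<otimes> (y \<otimes> x)"
    using assms(1,2) s by (simp add: m_assoc x) (simp add: m_assoc[symmetric] pow[OF assms(2) y] mult.commute)
  have c: "?c \<otimes> (y \<otimes> x) = x \<otimes> y"
    using assms(1,2) by (simp add: m_assoc)  (simp add: m_assoc[symmetric])
  have cc: "?c \<in> carrier G" using assms(1,2) by simp
  have "?c \<otimes> s [^] (k * l) \<otimes> (y \<otimes> x) = ?c \<otimes> (y \<otimes> x) \<otimes> s"
    using yx cc assms(1,2) s by (simp add: m_assoc)
  also have "\<dots> = s [^] (k * l) \<otimes> ?c \<otimes> (y \<otimes> x)"
    using xy c cc assms(1,2) s t by (simp add: m_assoc)
  finally have "?c \<otimes> s [^] (k * l) = s [^] (k * l) \<otimes> ?c"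
    using cc assms(1,2) s t by simp
  then have "?c \<otimes> (s [^] (k * l)) [^] m = (s [^] (k * l)) [^] m \<otimes> ?c"
    using group_commutes_pow[OF _ t cc] t cc by metis
  then show ?thesis using s m by (simp add: nat_pow_pow)
qed

text \<open>Field elements commute with \<open>singer\<close>, and \<open>frob\<close> conjugates it
  to its square, so the factor 1, \<open>frob\<close> or \<open>frob ** frob\<close> of
  \<open>A\<close> gives the exponent 1, 2 or 4.\<close>

lemma coc_kernel_singer:
  assumes "A \<in> coc_kernel"
  shows "\<exists>k\<in>{1,2,4::nat}. A ** singer = singer [^]\<^bsub>GL32\<^esub> k ** A"
proof -
  obtain v where v: "A = singer_alg v \<or> A = singer_alg v ** frob \<or> A = singer_alg v ** (frob ** frob)"
    using coc_kernel_cases[OF assms] by blast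
  \<comment> \<open>Moves \<open>singer\<close> first past \<open>B\<close> and then past the field
    element, with which every \<open>singer_alg w\<close> commutes.\<close>
  have push: "\<exists>k\<in>{1,2,4::nat}. A ** singer = singer [^]\<^bsub>GL32\<^esub> k ** A"
    if "A = singer_alg v ** B" "B ** singer = singer_alg w ** B" "singer [^]\<^bsub>GL32\<^esub> k = singer_alg w" "k \<in> {1,2,4}"
    for B w and k :: nat
  proof (rule bexI)
    have "A ** singer = singer_alg v ** (singer_alg w ** B)"
      by (simp add: that(1) that(2)[symmetric] matrix_mul_assoc)
    also have "\<dots> = singer [^]\<^bsub>GL32\<^esub> k ** A"
      by (simp add: that(1,3) matrix_mul_assoc singer_alg_comm)
    finally show "A ** singer = singer [^]\<^bsub>GL32\<^esub> k ** A" .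
  qed (fact that(4))
  from v consider "A = singer_alg v ** mat 1" | "A = singer_alg v ** frob" | "A = singer_alg v ** (frob ** frob)"
    by (auto simp: matrix_mul_rid)
  then show ?thesis
  proof cases
    case 1
    then show ?thesis
      by (rule push[of _ "axis 3 1" 1]) (simp_all add: singer_eq matrix_mul_lid matrix_mul_rid)
  next
    case 2
    then show ?thesis
      by (rule push[of _ "vector [1, 1, 0]" 2])
        (simp_all add: singer_pow_2, simp add: frob_def singer_def singer_alg_def mat_simps)
  next
    case 3
    then show ?thesis
      by (rule push[of _ "vector [0, 1, 1]" 4])
        (simp_all add: singer_pow_4, simp add: frob_def singer_def singer_alg_def mat_simps)
  qed
qed

text \<open>The field element in the factorisation of \<open>A\<close> commutes with
  \<open>singer\<close> and cancels, while \<open>frob\<close> and its square do not commute with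
  \<open>singer\<close>.\<close>

lemma coc_kernel_centralizer:
  assumes "A \<in> coc_kernel" "A ** singer = singer ** A"
  shows "\<exists>v. A = singer_alg v"
proof -
  obtain v where v: "v \<noteq> 0" "A = singer_alg v \<or> A = singer_alg v ** frob \<or> A = singer_alg v ** (frob ** frob)"
    using coc_kernel_cases[OF assms(1)] by blast
  have c: "singer_alg v ** singer = singer ** singer_alg v" by (simp add: singer_eq singer_alg_comm)
  have inj: "B = C" if "singer_alg v ** B = singer_alg v ** C" for B C
  proof -
    obtain D where D: "D ** singer_alg v = mat 1"
      using singer_alg_in_coc_kernel[OF v(1)] unfolding coc_kernel_def invertible_def by blast
    have "D ** (singer_alg v ** B) = D ** (singer_alg v ** C)" using that by simp
    then show ?thesis by (simp only: matrix_mul_assoc D matrix_mul_lid)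
  qed
  have "B ** singer = singer ** B" if "A = singer_alg v ** B" for B
  proof (rule inj)
    have "singer_alg v ** (B ** singer) = singer ** (singer_alg v ** B)"
      using assms(2) that by (simp add: matrix_mul_assoc)
    also have "\<dots> = singer_alg v ** (singer ** B)"
      using c by (simp add: matrix_mul_assoc)
    finally show "singer_alg v ** (B ** singer) = singer_alg v ** (singer ** B)" .
  qed
  moreover have "frob ** singer \<noteq> singer ** frob"
     "(frob ** frob) ** singer \<noteq> singer ** (frob ** frob)"
    by (simp_all add: frob_def singer_def mat_simps)
  ultimately show ?thesis using v(2) by blast
qed

text \<open>The second derived subgroup of \<open>H\<close> lies in the derived subgroup of the
  commutative group \<open>C\<close>, which is trivial.\<close>

lemma (in group) solvable_seq_if_derived_subset:
  assumes "subgroup H G" "derived G H \<subseteq> C" "subgroup C G"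
    and comm: "\<And>x y. x \<in> C \<Longrightarrow> y \<in> C \<Longrightarrow> x \<otimes> y = y \<otimes> x"
  shows "solvable_seq G H"
proof (rule trivial_derived_seq_imp_solvable[OF assms(1), of 2])
  interpret C: comm_group "G\<lparr>carrier := C\<rparr>"
    using subgroup_imp_group[OF assms(3)] comm by (intro group.group_comm_groupI) auto
  have "derived G (derived G H) \<subseteq> derived G C"
    by (rule mono_derived[OF assms(2)])
  also have "derived G C = {\<one>}"
    using C.derived_eq_singleton[of C] derived_consistent[OF _ assms(3), of C] by simp
  finally have "derived G (derived G H) \<subseteq> {\<one>}" .
  moreover have "\<one> \<in> derived G (derived G H)"
    by (intro subgroup.one_closed derived_is_subgroup derived_in_carrier subgroup.subset assms(1))
  ultimately show "(derived G ^^ 2) H = {\<one>}"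
    by (auto simp: numeral_2_eq_2)
qed

lemma (in group) subgroup_centralizer_in:
  assumes "subgroup H G" and s: "s \<in> carrier G"
  shows "subgroup {x \<in> H. x \<otimes> s = s \<otimes> x} G" (is "subgroup ?C G")
proof (rule subgroupI)
  interpret subgroup H G by (rule assms(1))
  show "?C \<subseteq> carrier G" by auto
  have "\<one> \<in> ?C" using s by simp
  then show "?C \<noteq> {}" by blast
  show "x \<otimes> y \<in> ?C" if "x \<in> ?C" "y \<in> ?C" for x y
  proof -
    have "x \<otimes> y \<otimes> s = x \<otimes> (y \<otimes> s)" using that s by (simp add: m_assoc)
    also have "\<dots> = x \<otimes> s \<otimes> y" using that s by (simp add: m_assoc[symmetric])
    also have "\<dots> = s \<otimes> (x \<otimes> y)" using that s by (simp add: m_assoc[symmetric])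
    finally show ?thesis using that by simp
  qed
  show "inv x \<in> ?C" if "x \<in> ?C" for x
  proof -
    have "inv x \<otimes> s = inv x \<otimes> (s \<otimes> x) \<otimes> inv x" using that s by (simp add: m_assoc)
    also have "\<dots> = inv x \<otimes> (x \<otimes> s) \<otimes> inv x" using that by simp
    also have "\<dots> = s \<otimes> inv x"
    proof -
      have "x \<in> carrier G" using that by simp
      then show ?thesis using s by (simp add: m_assoc[symmetric])
    qed
    finally show ?thesis using that by simp
  qed
qed

lemma coc_kernel_subset: "coc_kernel \<subseteq> carrier GL32"
  by (auto simp: coc_kernel_def)

text \<open>Commutators centralise \<open>singer\<close>, hence are field elements, and these
  commute with each other.\<close>

lemma solvable_seq_coc_kernel: "solvable_seq GL32 coc_kernel"
proof -
  interpret subgroup coc_kernel GL32 by (rule subgroup_coc_kernel)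
  let ?s = "singer" let ?C = "{A \<in> coc_kernel. A ** ?s = ?s ** A}"
  have s: "?s \<in> coc_kernel" by (simp add: singer_eq singer_alg_in_coc_kernel)
  have C: "subgroup ?C GL32"
    using GL.subgroup_centralizer_in[OF subgroup_coc_kernel, of ?s] s coc_kernel_subset by auto
  have "derived_set GL32 coc_kernel \<subseteq> ?C"
  proof
    fix c assume "c \<in> derived_set GL32 coc_kernel"
    then obtain A B where A: "A \<in> coc_kernel" and B: "B \<in> coc_kernel"
      and c: "c = A \<otimes>\<^bsub>GL32\<^esub> B \<otimes>\<^bsub>GL32\<^esub> inv\<^bsub>GL32\<^esub> A \<otimes>\<^bsub>GL32\<^esub> inv\<^bsub>GL32\<^esub> B" by blast
    have cS: "c \<in> coc_kernel" unfolding c using A B by (intro m_closed m_inv_closed)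
    obtain k l where k: "k \<in> {1,2,4::nat}" "A ** singer = singer [^]\<^bsub>GL32\<^esub> k ** A"
        and l: "l \<in> {1,2,4::nat}" "B ** singer = singer [^]\<^bsub>GL32\<^esub> l ** B"
      using coc_kernel_singer A B by meson
    \<comment> \<open>\<open>k * l\<close> is a power of 2 dividing 16, hence divides 64, and 64 is
      1 modulo 7, the exponent that kills \<open>singer\<close>.\<close>
    have "k * l * (64 div (k * l)) = 64" using k(1) l(1) by auto
    moreover have "singer [^]\<^bsub>GL32\<^esub> (64::nat) = singer"
    proof -
      have "singer [^]\<^bsub>GL32\<^esub> (64::nat) = (singer [^]\<^bsub>GL32\<^esub> (7::nat)) [^]\<^bsub>GL32\<^esub> (9::nat) \<otimes>\<^bsub>GL32\<^esub> singer"
        using s coc_kernel_subset GL.nat_pow_Suc[of singer 63] by (simp add: GL.nat_pow_pow subset_iff)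
      also have "\<dots> = singer"
      proof -
        have "\<one>\<^bsub>GL32\<^esub> [^]\<^bsub>GL32\<^esub> (9::nat) = \<one>\<^bsub>GL32\<^esub>" by (rule GL.nat_pow_one)
        then show ?thesis by (simp add: singer_pow_7 matrix_mul_lid)
      qed
      finally show ?thesis .
    qed
    ultimately have "singer [^]\<^bsub>GL32\<^esub> (k * l * (64 div (k * l))) = singer" by simp
    then have "c \<otimes>\<^bsub>GL32\<^esub> singer = singer \<otimes>\<^bsub>GL32\<^esub> c"
      unfolding c using A B s coc_kernel_subset k(2) l(2)
      by (intro GL.commutator_centralizes) (auto simp: subset_iff)
    then show "c \<in> ?C" using cS by simp
  qed
  then have "derived GL32 coc_kernel \<subseteq> ?C"
    unfolding derived_def by (rule GL.generate_subgroup_incl[OF _ C])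
  moreover have "A ** B = B ** A" if "A \<in> ?C" "B \<in> ?C" for A B
    using that coc_kernel_centralizer[of A] coc_kernel_centralizer[of B] singer_alg_comm by auto
  ultimately show ?thesis
    using GL.solvable_seq_if_derived_subset[OF subgroup_coc_kernel _ C] by simp
qed

section \<open>Insolubility of GL(3,2) by transvections\<close>

definition mat_unit :: "'n \<Rightarrow> 'n \<Rightarrow> bit^'n^'n"
  where "mat_unit i j = (\<chi> a b. of_bool (a = i \<and> b = j))"

lemma mat_unit_mult: "mat_unit i j ** mat_unit k l = (if j = k then mat_unit i l else 0)"
proof -
  have "(\<Sum>c\<in>UNIV. of_bool (a = i \<and> c = j) * of_bool (c = k \<and> b = l))
     = (\<Sum>c\<in>UNIV. if c = j then of_bool (a = i \<and> j = k \<and> b = l) else (0::bit))" for a b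
    by (rule sum.cong) auto
  then show ?thesis
    by (simp add: mat_unit_def matrix_matrix_mult_def vec_eq_iff del: mult_bit_eq_and)
qed

definition transvection :: "'n::finite \<Rightarrow> 'n \<Rightarrow> bit^'n^'n"
  where "transvection i j = mat 1 + mat_unit i j"

lemma mat_add_self_bit [simp]: "A + A = (0::bit^'n^'m)" "A + (A + B) = (B::bit^'n^'m)"
  by (simp_all add: vec_eq_iff del: add_bit_eq_xor)

lemma matrix_add_rdistrib: "(B + C) ** A = B ** A + C ** A" for A :: "'a::semiring_1^'n^'m"
  by (simp add: matrix_matrix_mult_def vec_eq_iff distrib_right sum.distrib)

lemma transvection_sq: "i \<noteq> j \<Longrightarrow> transvection i j ** transvection i j = mat 1"
  by (simp add: transvection_def matrix_add_ldistrib matrix_add_rdistrib mat_unit_mult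
     matrix_mul_lid matrix_mul_rid ac_simps)

text \<open>The Steinberg relation. The left side is a commutator because transvections are
  involutions in characteristic 2.\<close>

lemma transvection_commutator:
  assumes "i \<noteq> j" "k \<noteq> i" "k \<noteq> j"
  shows "transvection i k ** transvection k j ** transvection i k ** transvection k j = transvection i j"
  using assms by (simp add: transvection_def matrix_add_ldistrib matrix_add_rdistrib mat_unit_mult
     matrix_mul_lid matrix_mul_rid ac_simps)

text \<open>By monotonicity of \<open>derived\<close>, \<open>T\<close> survives in every term of
  the derived series.\<close>

lemma (in group) not_solvable_if_derived_superset:
  assumes "T \<subseteq> carrier G" "T \<subseteq> derived G T" "t \<in> T" "t \<noteq> \<one>"
  shows "\<not> solvable G"
proof
  assume "solvable G"
  then obtain n where n: "(derived G ^^ n) (carrier G) = {\<one>}"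
    by (auto simp: solvable_iff_trivial_derived_seq)
  have "T \<subseteq> (derived G ^^ n) (carrier G)" for n
  proof (induction n)
    case (Suc n)
    then show ?case using mono_derived[OF Suc] assms(2) by auto
  qed (use assms(1) in simp)
  with n assms(3,4) show False by blast
qed

lemma commutator_in_derived:
  assumes "a \<in> A" "b \<in> A"
  shows "a \<otimes>\<^bsub>G\<^esub> b \<otimes>\<^bsub>G\<^esub> inv\<^bsub>G\<^esub> a \<otimes>\<^bsub>G\<^esub> inv\<^bsub>G\<^esub> b \<in> derived G A"
  unfolding derived_def using assms by (auto intro: generate.incl)

lemma not_solvable_GL32: "\<not> solvable GL32"
proof (rule GL.not_solvable_if_derived_superset)
  let ?T = "{transvection i j |i j :: 3. i \<noteq> j}"
  note sq = transvection_sq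
  have inv: "invertible (transvection i j)" if "i \<noteq> j" for i j :: 3
    unfolding invertible_def using sq[OF that] by blast
  then show T: "?T \<subseteq> carrier GL32" by auto
  have inv_eq: "inv\<^bsub>GL32\<^esub> (transvection i j) = transvection i j" if "i \<noteq> j" for i j :: 3
    using GL.inv_equality[of "transvection i j" "transvection i j"] sq[OF that] inv[OF that] by simp
  show "?T \<subseteq> derived GL32 ?T"
  proof
    fix A assume "A \<in> ?T"
    then obtain i j :: 3 where ij: "i \<noteq> j" "A = transvection i j" by blast
    \<comment> \<open>Dimension 3 supplies the third index that exhibits a transvection as a
      commutator of two others.\<close>
    have "card {i, j} < card (UNIV :: 3 set)" by (simp add: card_insert_if)
    then have "{i, j} \<noteq> UNIV" by force
    then obtain k :: 3 where k: "k \<noteq> i" "k \<noteq> j" by blast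
    have "A = transvection i k ** transvection k j ** transvection i k ** transvection k j"
      using transvection_commutator[OF ij(1) k] ij(2) by simp
    then have A: "A = transvection i k \<otimes>\<^bsub>GL32\<^esub> transvection k j \<otimes>\<^bsub>GL32\<^esub>
        inv\<^bsub>GL32\<^esub> (transvection i k) \<otimes>\<^bsub>GL32\<^esub> inv\<^bsub>GL32\<^esub> (transvection k j)"
      using k by (simp add: inv_eq)
    show "A \<in> derived GL32 ?T"
      unfolding A by (rule commutator_in_derived) (use k in blast)+
  qed
  show "transvection 1 2 \<in> ?T" by force
  show "transvection 1 2 \<noteq> \<one>\<^bsub>GL32\<^esub>" by (simp add: transvection_def mat_unit_def mat_simps)
qed

section \<open>Crossed actions and subgroups of the holomorph\<close>

lemma semidirect_simps [simp]:
  "carrier (semidirect K H act) = carrier K \<times> carrier H"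
  "one (semidirect K H act) = (\<one>\<^bsub>K\<^esub>, \<one>\<^bsub>H\<^esub>)"
  "(a, s) \<otimes>\<^bsub>semidirect K H act\<^esub> (b, t) = (a \<otimes>\<^bsub>K\<^esub> act s b, s \<otimes>\<^bsub>H\<^esub> t)"
  by (simp_all add: semidirect_def)

lemma group_semidirect:
  assumes "group K" "group H"
    and hom: "\<And>s. s \<in> carrier H \<Longrightarrow> act s \<in> hom K K"
    and one: "\<And>a. a \<in> carrier K \<Longrightarrow> act \<one>\<^bsub>H\<^esub> a = a"
    and mult: "\<And>s t a. s \<in> carrier H \<Longrightarrow> t \<in> carrier H \<Longrightarrow> a \<in> carrier K \<Longrightarrow>
      act (s \<otimes>\<^bsub>H\<^esub> t) a = act s (act t a)"
  shows "group (semidirect K H act)"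
proof -
  interpret K: group K by fact
  interpret H: group H by fact
  have closed: "act s a \<in> carrier K" if "s \<in> carrier H" "a \<in> carrier K" for s a
    using hom[OF that(1)] that(2) by (auto simp: hom_def)
  have dist: "act s (a \<otimes>\<^bsub>K\<^esub> b) = act s a \<otimes>\<^bsub>K\<^esub> act s b"
    if "s \<in> carrier H" "a \<in> carrier K" "b \<in> carrier K" for s a b
    using hom[OF that(1)] that(2,3) by (auto simp: hom_def)
  show ?thesis
  proof (rule groupI)
    fix x assume "x \<in> carrier (semidirect K H act)"
    then obtain a s where x: "x = (a, s)" "a \<in> carrier K" "s \<in> carrier H" by auto
    show "\<exists>y\<in>carrier (semidirect K H act). y \<otimes>\<^bsub>semidirect K H act\<^esub> x = \<one>\<^bsub>semidirect K H act\<^esub>"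
    proof
      show "(inv\<^bsub>K\<^esub> (act (inv\<^bsub>H\<^esub> s) a), inv\<^bsub>H\<^esub> s) \<in> carrier (semidirect K H act)"
        using x closed by simp
      show "(inv\<^bsub>K\<^esub> (act (inv\<^bsub>H\<^esub> s) a), inv\<^bsub>H\<^esub> s) \<otimes>\<^bsub>semidirect K H act\<^esub> x = \<one>\<^bsub>semidirect K H act\<^esub>"
        using x closed by simp
    qed
  qed (auto simp: closed dist one mult K.m_assoc H.m_assoc)
qed

lemma product_group_permute_hom:
  assumes "bij_betw p I I"
  shows "(\<lambda>f. \<lambda>i\<in>I. f (p i)) \<in> hom (product_group I (\<lambda>_. K)) (product_group I (\<lambda>_. K))"
  using bij_betwE[OF assms] by (auto simp: hom_def PiE_iff fun_eq_iff)

lemma wreath_simps [simp]: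
  "carrier (wreath K r H) = ({1..r} \<rightarrow>\<^sub>E carrier K) \<times> H"
  "one (wreath K r H) = ((\<lambda>i\<in>{1..r}. \<one>\<^bsub>K\<^esub>), id)"
  "(f, h) \<otimes>\<^bsub>wreath K r H\<^esub> (g, k) =
     ((\<lambda>i\<in>{1..r}. f i \<otimes>\<^bsub>K\<^esub> g (Hilbert_Choice.inv h i)), h \<circ> k)"
  by (auto simp: wreath_def sym_group_def fun_eq_iff)

lemma group_wreath:
  assumes K: "group K" and H: "subgroup H (sym_group r)"
  shows "group (wreath K r H)"
  unfolding wreath_def
proof (rule group_semidirect)
  have perm: "h permutes {1..r}" if "h \<in> H" for h
    using subgroup.subset[OF H] that sym_group_carrier by blast
  show "group ((sym_group r)\<lparr>carrier := H\<rparr>)"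
    by (rule group.subgroup_imp_group[OF sym_group_is_group H])
  show "(\<lambda>f. \<lambda>i\<in>{1..r}. f (Hilbert_Choice.inv s i)) \<in>
      hom (product_group {1..r} (\<lambda>_. K)) (product_group {1..r} (\<lambda>_. K))"
    if "s \<in> carrier ((sym_group r)\<lparr>carrier := H\<rparr>)" for s
    using that by (intro product_group_permute_hom permutes_imp_bij permutes_inv perm) simp
  fix s t f
  assume "s \<in> carrier ((sym_group r)\<lparr>carrier := H\<rparr>)" "t \<in> carrier ((sym_group r)\<lparr>carrier := H\<rparr>)"
  then have s: "s permutes {1..r}" "t permutes {1..r}" using perm by auto
  \<comment> \<open>Needed to evaluate the inner restricted function inside its domain.\<close>
  have "Hilbert_Choice.inv s i \<in> {1..r}" if "i \<in> {1..r}" for i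
    using that s(1) permutes_in_image permutes_inv by metis
  then show "(\<lambda>i\<in>{1..r}. f (Hilbert_Choice.inv (s \<otimes>\<^bsub>(sym_group r)\<lparr>carrier := H\<rparr>\<^esub> t) i)) =
    (\<lambda>i\<in>{1..r}. (\<lambda>i\<in>{1..r}. f (Hilbert_Choice.inv t i)) (Hilbert_Choice.inv s i))"
    using s by (auto simp: fun_eq_iff sym_group_mult permutes_inv_o o_inv_distrib permutes_bij)
next
  fix f assume "f \<in> carrier (product_group {1..r} (\<lambda>_. K))"
  then show "(\<lambda>i\<in>{1..r}. f (Hilbert_Choice.inv \<one>\<^bsub>(sym_group r)\<lparr>carrier := H\<rparr>\<^esub> i)) = f"
    by (auto simp: fun_eq_iff sym_group_one PiE_iff extensional_def)
qed (simp add: K)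

lemma group_holomorph:
  assumes "group N"
  shows "group (holomorph N)"
  unfolding holomorph_def
proof (rule group_semidirect)
  interpret group N by fact
  show "group (AutoGroup N)" by (rule AutoGroup)
  show "\<theta> \<in> hom N N" if "\<theta> \<in> carrier (AutoGroup N)" for \<theta>
    using that by (auto simp: AutoGroup_def auto_def)
qed (auto simp: assms AutoGroup_def BijGroup_def auto_def compose_def)

text \<open>\<open>K\<close> acts on \<open>N\<close> by the affine maps sending \<open>a\<close> to
  the product of \<open>coc x\<close> and \<open>act x a\<close>. Faithfulness embeds
  \<open>K\<close> in the holomorph, and surjectivity of \<open>coc\<close> says that the orbit of
  the identity is all of \<open>N\<close>.\<close>

locale crossed_action =
  N: group N + K: group K for N :: "('a, 'b) monoid_scheme" and K :: "('k, 'c) monoid_scheme" +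
  fixes act :: "'k \<Rightarrow> 'a \<Rightarrow> 'a" and coc :: "'k \<Rightarrow> 'a"
  assumes act_hom: "x \<in> carrier K \<Longrightarrow> act x \<in> hom N N"
    and act_one: "a \<in> carrier N \<Longrightarrow> act \<one>\<^bsub>K\<^esub> a = a"
    and act_mult: "\<lbrakk>x \<in> carrier K; y \<in> carrier K; a \<in> carrier N\<rbrakk> \<Longrightarrow>
       act (x \<otimes>\<^bsub>K\<^esub> y) a = act x (act y a)"
    and act_faithful: "\<lbrakk>x \<in> carrier K; y \<in> carrier K; \<And>a. a \<in> carrier N \<Longrightarrow> act x a = act y a\<rbrakk>
       \<Longrightarrow> x = y"
    and coc_surj: "coc ` carrier K = carrier N"
    and coc_mult: "\<lbrakk>x \<in> carrier K; y \<in> carrier K\<rbrakk> \<Longrightarrow>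
       coc (x \<otimes>\<^bsub>K\<^esub> y) = coc x \<otimes>\<^bsub>N\<^esub> act x (coc y)"
begin

definition hol_elem :: "'k \<Rightarrow> 'a \<times> ('a \<Rightarrow> 'a)"
  where "hol_elem x = (coc x, restrict (act x) (carrier N))"

definition hol_image :: "('a \<times> ('a \<Rightarrow> 'a)) set"
  where "hol_image = hol_elem ` carrier K"

lemma coc_closed: "x \<in> carrier K \<Longrightarrow> coc x \<in> carrier N"
  using coc_surj by blast

lemma act_closed: "x \<in> carrier K \<Longrightarrow> a \<in> carrier N \<Longrightarrow> act x a \<in> carrier N"
  using act_hom by (auto simp: hom_def)

lemma act_inv:
  assumes "x \<in> carrier K" "a \<in> carrier N"
  shows "act (inv\<^bsub>K\<^esub> x) (act x a) = a" "act x (act (inv\<^bsub>K\<^esub> x) a) = a"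
  using assms act_mult[of "inv\<^bsub>K\<^esub> x" x a] act_mult[of x "inv\<^bsub>K\<^esub> x" a] act_one
  by auto

lemma act_auto:
  assumes x: "x \<in> carrier K"
  shows "restrict (act x) (carrier N) \<in> auto N"
proof -
  have "bij_betw (act x) (carrier N) (carrier N)"
    by (rule bij_betwI[of _ _ _ "act (inv\<^bsub>K\<^esub> x)"]) (use x act_closed act_inv in auto)
  then have "bij_betw (restrict (act x) (carrier N)) (carrier N) (carrier N)"
    by (subst bij_betw_restrict_eq)
  moreover have "restrict (act x) (carrier N) \<in> hom N N"
    using act_hom[OF x] by (auto simp: hom_def)
  ultimately show ?thesis by (simp add: auto_def Bij_def)
qed

lemma hol_elem_hom: "hol_elem \<in> hom K (holomorph N)"
proof (rule homI)
  fix x y assume x: "x \<in> carrier K" and y: "y \<in> carrier K"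
  show "hol_elem x \<in> carrier (holomorph N)"
    using x act_auto coc_closed by (simp add: hol_elem_def holomorph_def AutoGroup_def)
  have "restrict (act x) (carrier N) \<otimes>\<^bsub>AutoGroup N\<^esub> restrict (act y) (carrier N)
     = restrict (act (x \<otimes>\<^bsub>K\<^esub> y)) (carrier N)"
    using act_auto[OF x] act_auto[OF y] x y act_closed
    by (auto simp: AutoGroup_def BijGroup_def auto_def compose_def act_mult fun_eq_iff)
  then show "hol_elem (x \<otimes>\<^bsub>K\<^esub> y) = hol_elem x \<otimes>\<^bsub>holomorph N\<^esub> hol_elem y"
    using x y coc_closed by (simp add: hol_elem_def holomorph_def coc_mult)
qed

lemma hol_elem_inj: "inj_on hol_elem (carrier K)"
proof (rule inj_onI)
  fix x y assume x: "x \<in> carrier K" and y: "y \<in> carrier K" and "hol_elem x = hol_elem y"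
  then have "restrict (act x) (carrier N) = restrict (act y) (carrier N)" by (simp add: hol_elem_def)
  then show "x = y" using act_faithful[OF x y] by (metis restrict_apply')
qed

sublocale hol: group_hom K "holomorph N" hol_elem
  using hol_elem_hom group_holomorph[OF N.is_group]
  by (simp add: group_hom_def group_hom_axioms_def K.is_group)

lemma hol_image_subgroup: "subgroup hol_image (holomorph N)"
  unfolding hol_image_def by (rule hol.img_is_subgroup)

lemma hol_image_iso: "hol_subgroup N hol_image \<cong> K"
proof -
  have "hol_elem \<in> iso K (hol_subgroup N hol_image)"
    using hol_elem_hom hol_elem_inj by (auto simp: iso_def hom_def hol_image_def bij_betw_def)
  then show ?thesis using K.iso_sym is_isoI by blast
qed

lemma fst_hol_elem: "fst (hol_elem x) = coc x"
  by (simp add: hol_elem_def)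

lemma hol_act_hol_elem:
  "a \<in> carrier N \<Longrightarrow> hol_act N (hol_elem x) a = coc x \<otimes>\<^bsub>N\<^esub> act x a"
  by (simp add: hol_act_def hol_elem_def)

lemma coc_one: "coc \<one>\<^bsub>K\<^esub> = \<one>\<^bsub>N\<^esub>"
  using coc_mult[of "\<one>\<^bsub>K\<^esub>" "\<one>\<^bsub>K\<^esub>"] act_one coc_closed[of "\<one>\<^bsub>K\<^esub>"] by simp

lemma act_N_one: "x \<in> carrier K \<Longrightarrow> act x \<one>\<^bsub>N\<^esub> = \<one>\<^bsub>N\<^esub>"
  using act_hom hom_one N.is_group by blast

lemma act_dist:
  "\<lbrakk>x \<in> carrier K; a \<in> carrier N; b \<in> carrier N\<rbrakk> \<Longrightarrow> act x (a \<otimes>\<^bsub>N\<^esub> b) = act x a \<otimes>\<^bsub>N\<^esub> act x b"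
  using act_hom by (auto simp: hom_def)

text \<open>The cocycle identity says that the affine maps compose as the elements of
  \<open>K\<close> do; this gives both their inverses and the action of the image.\<close>

lemma affine_mult:
  assumes "x \<in> carrier K" "y \<in> carrier K" "a \<in> carrier N"
  shows "coc (x \<otimes>\<^bsub>K\<^esub> y) \<otimes>\<^bsub>N\<^esub> act (x \<otimes>\<^bsub>K\<^esub> y) a = coc x \<otimes>\<^bsub>N\<^esub> act x (coc y \<otimes>\<^bsub>N\<^esub> act y a)"
  using assms by (simp add: coc_mult act_mult act_dist N.m_assoc coc_closed act_closed)

lemma transitive_hol_image: "transitive_hol_subgroup N hol_image"
proof -
  have grp: "group (hol_subgroup N hol_image)"
    by (rule group.subgroup_imp_group[OF group_holomorph[OF N.is_group] hol_image_subgroup])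
  have bij: "hol_act N g \<in> Bij (carrier N)" if g: "g \<in> hol_image" for g
  proof -
    obtain x where x: "x \<in> carrier K" "g = hol_elem x" using g by (auto simp: hol_image_def)
    have "bij_betw (\<lambda>a. coc x \<otimes>\<^bsub>N\<^esub> act x a) (carrier N) (carrier N)"
    proof (rule bij_betwI[of _ _ _ "\<lambda>a. coc (inv\<^bsub>K\<^esub> x) \<otimes>\<^bsub>N\<^esub> act (inv\<^bsub>K\<^esub> x) a"])
      show "coc (inv\<^bsub>K\<^esub> x) \<otimes>\<^bsub>N\<^esub> act (inv\<^bsub>K\<^esub> x) (coc x \<otimes>\<^bsub>N\<^esub> act x a) = a"
        if "a \<in> carrier N" for a
        using affine_mult[of "inv\<^bsub>K\<^esub> x" x a] x that by (simp add: coc_one act_one)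
      show "coc x \<otimes>\<^bsub>N\<^esub> act x (coc (inv\<^bsub>K\<^esub> x) \<otimes>\<^bsub>N\<^esub> act (inv\<^bsub>K\<^esub> x) a) = a"
        if "a \<in> carrier N" for a
        using affine_mult[of x "inv\<^bsub>K\<^esub> x" a] x that by (simp add: coc_one act_one)
    qed (use x coc_closed act_closed in auto)
    then have "bij_betw (hol_act N g) (carrier N) (carrier N)"
      by (rule bij_betw_cong[THEN iffD1, rotated]) (simp add: x hol_act_hol_elem)
    then show ?thesis by (simp add: Bij_def hol_act_def)
  qed
  have "hol_act N \<in> hom (hol_subgroup N hol_image) (BijGroup (carrier N))"
  proof (rule homI)
    fix g h assume gh: "g \<in> carrier (hol_subgroup N hol_image)" "h \<in> carrier (hol_subgroup N hol_image)"
    show "hol_act N g \<in> carrier (BijGroup (carrier N))"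
      using bij gh by (simp add: BijGroup_def)
    obtain x y where xy: "x \<in> carrier K" "g = hol_elem x" "y \<in> carrier K" "h = hol_elem y"
      using gh by (auto simp: hol_image_def)
    have gh': "g \<otimes>\<^bsub>holomorph N\<^esub> h = hol_elem (x \<otimes>\<^bsub>K\<^esub> y)"
      using xy by simp
    have "hol_act N (g \<otimes>\<^bsub>holomorph N\<^esub> h) a = compose (carrier N) (hol_act N g) (hol_act N h) a" for a
    proof (cases "a \<in> carrier N")
      case True
      then show ?thesis
        unfolding gh' using xy affine_mult[of x y a] coc_closed act_closed
        by (simp add: compose_def hol_act_hol_elem del: hol.hom_mult)
    qed (simp add: hol_act_def compose_def)
    then show "hol_act N (g \<otimes>\<^bsub>hol_subgroup N hol_image\<^esub> h) =
        hol_act N g \<otimes>\<^bsub>BijGroup (carrier N)\<^esub> hol_act N h"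
      using bij gh by (simp add: BijGroup_def fun_eq_iff)
  qed
  then have "group_hom (hol_subgroup N hol_image) (BijGroup (carrier N)) (hol_act N)"
    using grp group_BijGroup by (simp add: group_hom_def group_hom_axioms_def)
  moreover have "\<exists>g\<in>carrier (hol_subgroup N hol_image). hol_act N g a = b"
    if ab: "a \<in> carrier N" "b \<in> carrier N" for a b
  proof -
    obtain x y where x: "x \<in> carrier K" "coc x = a" and y: "y \<in> carrier K" "coc y = b"
      using ab[folded coc_surj] by blast
    \<comment> \<open>\<open>x\<close> sends the identity to \<open>a\<close> and \<open>y\<close>
      sends it to \<open>b\<close>.\<close>
    let ?g = "y \<otimes>\<^bsub>K\<^esub> inv\<^bsub>K\<^esub> x"
    have "coc ?g \<otimes>\<^bsub>N\<^esub> act ?g a = coc (?g \<otimes>\<^bsub>K\<^esub> x)"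
      using x y by (simp add: coc_mult)
    also have "\<dots> = b" using x y by (simp add: K.m_assoc)
    finally have "hol_act N (hol_elem ?g) a = b" using that by (simp add: hol_act_hol_elem)
    moreover have "hol_elem ?g \<in> hol_image"
      unfolding hol_image_def using x y by (intro imageI) simp
    ultimately show ?thesis by auto
  qed
  ultimately show ?thesis
    unfolding transitive_hol_subgroup_def transitive_action_def group_action_def
      transitive_action_axioms_def
    using hol_image_subgroup by auto
qed

text \<open>\<open>x\<close> sends the identity of \<open>N\<close> to \<open>coc x\<close>, so this
  is the stabiliser of the identity.\<close>

abbreviation (input) point_stab :: "'k set"
  where "point_stab \<equiv> {x \<in> carrier K. coc x = \<one>\<^bsub>N\<^esub>}"

text \<open>By transitivity the stabiliser of \<open>a\<close> is conjugate to that of the identity,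
  by any \<open>y\<close> with \<open>coc y = a\<close>; solubility passes along the conjugation
  homomorphism.\<close>

lemma solvable_stabilizer:
  assumes "solvable_seq K point_stab" and a: "a \<in> carrier N"
  shows "solvable (hol_subgroup N (stabilizer (hol_subgroup N hol_image) (hol_act N) a))"
proof -
  let ?G = "hol_subgroup N hol_image"
  obtain y where y: "y \<in> carrier K" "coc y = a" using a coc_surj by (metis imageE)
  have cancel: "y \<otimes>\<^bsub>K\<^esub> (inv\<^bsub>K\<^esub> y \<otimes>\<^bsub>K\<^esub> w) = w"
    "inv\<^bsub>K\<^esub> y \<otimes>\<^bsub>K\<^esub> (y \<otimes>\<^bsub>K\<^esub> w) = w" if "w \<in> carrier K" for w
    using that y by (simp_all add: K.m_assoc[symmetric])
  have st: "stabilizer ?G (hol_act N) a =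
     (\<lambda>x. hol_elem (y \<otimes>\<^bsub>K\<^esub> x \<otimes>\<^bsub>K\<^esub> inv\<^bsub>K\<^esub> y)) ` point_stab" (is "?S = ?f ` _")
  proof (intro equalityI subsetI)
    fix g assume "g \<in> ?S"
    then obtain x where x: "x \<in> carrier K" "g = hol_elem x" "hol_act N g a = a"
      by (auto simp: stabilizer_def hol_image_def)
    have xy: "coc (x \<otimes>\<^bsub>K\<^esub> y) = a" using x y a by (simp add: hol_act_hol_elem coc_mult)
    let ?z = "inv\<^bsub>K\<^esub> y \<otimes>\<^bsub>K\<^esub> x \<otimes>\<^bsub>K\<^esub> y"
    have "coc ?z = coc (inv\<^bsub>K\<^esub> y) \<otimes>\<^bsub>N\<^esub> act (inv\<^bsub>K\<^esub> y) (coc (x \<otimes>\<^bsub>K\<^esub> y))"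
      using x y by (simp add: coc_mult[symmetric] K.m_assoc)
    also have "\<dots> = coc (inv\<^bsub>K\<^esub> y \<otimes>\<^bsub>K\<^esub> y)"
      using y coc_mult[OF K.inv_closed[OF y(1)] y(1)] by (simp add: xy del: K.l_inv)
    finally have "?z \<in> point_stab" using x y by (simp add: coc_one)
    moreover have "g = ?f ?z" using x y by (simp add: K.m_assoc cancel del: hol.hom_mult)
    ultimately show "g \<in> ?f ` point_stab" by blast
  next
    fix g assume "g \<in> ?f ` point_stab"
    then obtain x where x: "x \<in> carrier K" "coc x = \<one>\<^bsub>N\<^esub>" "g = ?f x" by blast
    let ?z = "y \<otimes>\<^bsub>K\<^esub> x \<otimes>\<^bsub>K\<^esub> inv\<^bsub>K\<^esub> y"
    have z: "?z \<in> carrier K" using x y by simp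
    have "hol_act N g a = coc (?z \<otimes>\<^bsub>K\<^esub> y)"
      unfolding x(3) hol_act_hol_elem[OF a] by (simp add: coc_mult[OF z y(1)] y(2))
    also have "?z \<otimes>\<^bsub>K\<^esub> y = y \<otimes>\<^bsub>K\<^esub> x"
      using x y by (simp add: K.m_assoc)
    also have "coc (y \<otimes>\<^bsub>K\<^esub> x) = a"
      using x y a by (simp add: coc_mult act_N_one)
    finally have "hol_act N g a = a" .
    moreover have "g \<in> hol_image" unfolding x(3) hol_image_def using z by (rule imageI)
    ultimately show "g \<in> ?S" by (simp add: stabilizer_def)
  qed
  have "?f \<in> hom K (holomorph N)"
  proof (rule homI)
    fix x z assume "x \<in> carrier K" "z \<in> carrier K"
    then have "y \<otimes>\<^bsub>K\<^esub> (x \<otimes>\<^bsub>K\<^esub> z) \<otimes>\<^bsub>K\<^esub> inv\<^bsub>K\<^esub> y =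
        (y \<otimes>\<^bsub>K\<^esub> x \<otimes>\<^bsub>K\<^esub> inv\<^bsub>K\<^esub> y) \<otimes>\<^bsub>K\<^esub> (y \<otimes>\<^bsub>K\<^esub> z \<otimes>\<^bsub>K\<^esub> inv\<^bsub>K\<^esub> y)"
      using y by (simp add: K.m_assoc cancel)
    then show "?f (x \<otimes>\<^bsub>K\<^esub> z) = ?f x \<otimes>\<^bsub>holomorph N\<^esub> ?f z"
      using \<open>x \<in> carrier K\<close> \<open>z \<in> carrier K\<close> y
      by (simp del: hol.hom_mult add: hol.hom_mult[symmetric])
  qed (use y in simp)
  then interpret f: group_hom K "holomorph N" ?f
    by (intro group_hom.intro group_hom_axioms.intro K.is_group hol.H.is_group)
  have seq: "solvable_seq (holomorph N) ?S"
    unfolding st by (rule f.solvable_imp_solvable_img[OF assms(1)])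
  then have S: "subgroup ?S (holomorph N)"
    by (rule hol.H.solvable_imp_subgroup)
  \<comment> \<open>Pulling back along the inclusion turns solubility inside the holomorph into
    solubility of the stabiliser as a group of its own.\<close>
  interpret i: group_hom "hol_subgroup N ?S" "holomorph N" id
    by (rule hol.H.canonical_inj_is_hom[OF S])
  have "solvable_seq (hol_subgroup N ?S) (carrier (hol_subgroup N ?S))"
    by (rule i.solvable_img_imp_solvable[OF i.G.subgroup_self]) (use seq in simp_all)
  then show ?thesis by (simp only: solvable_def)
qed

text \<open>Choose \<open>y\<close> with \<open>coc y = m\<close>. Both \<open>x\<close> and
  \<open>y\<close> have cocycle value in \<open>M\<close>, hence so has their product, and its value
  is \<open>act x m\<close> because that of \<open>x\<close> is trivial.\<close>

lemma admissible_imp_stab_invariant: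
  assumes "admissible N hol_image M" "x \<in> point_stab" "m \<in> M"
  shows "act x m \<in> M"
proof -
  have M: "subgroup M N" and S: "subgroup {g \<in> hol_image. fst g \<in> M} (hol_subgroup N hol_image)"
    using assms(1) by (auto simp: admissible_def)
  have m: "m \<in> carrier N" using M assms(3) subgroup.mem_carrier by metis
  then obtain y where y: "y \<in> carrier K" "coc y = m" using coc_surj by (metis imageE)
  have "hol_elem x \<in> {g \<in> hol_image. fst g \<in> M}" "hol_elem y \<in> {g \<in> hol_image. fst g \<in> M}"
    using assms(2,3) y subgroup.one_closed[OF M] by (auto simp: hol_image_def fst_hol_elem)
  from subgroup.m_closed[OF S this] have "fst (hol_elem (x \<otimes>\<^bsub>K\<^esub> y)) \<in> M"
    using assms(2) y by simp
  moreover have "fst (hol_elem (x \<otimes>\<^bsub>K\<^esub> y)) = act x m"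
    using assms(2) y m act_closed by (simp add: hol_elem_def coc_mult)
  ultimately show ?thesis by simp
qed

lemma invariant_imp_stab_invariant:
  assumes "invariant N hol_image M" "x \<in> point_stab" "m \<in> M"
  shows "act x m \<in> M"
proof -
  have m: "m \<in> carrier N" using assms subgroup.mem_carrier unfolding invariant_def by metis
  have "snd (hol_elem x) m \<in> M"
    using assms by (auto simp: invariant_def hol_image_def)
  then show ?thesis using m by (simp add: hol_elem_def)
qed

end

section \<open>Elementary abelian 2-groups\<close>

text \<open>For finite \<open>I\<close>, the vector space over the field with two elements with
  basis \<open>I\<close>, each vector given by its support. It is the common model for elementary
  abelian 2-groups of equal order.\<close>

definition symdiff_group :: "'i set \<Rightarrow> 'i set monoid"
  where "symdiff_group I = \<lparr>carrier = Pow I, monoid.mult = (\<lambda>A B. (A - B) \<union> (B - A)), one = {}\<rparr>"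

lemma symdiff_group_simps [simp]:
  "carrier (symdiff_group I) = Pow I" "one (symdiff_group I) = {}"
  "A \<otimes>\<^bsub>symdiff_group I\<^esub> B = (A - B) \<union> (B - A)"
  by (simp_all add: symdiff_group_def)

lemma group_symdiff_group: "group (symdiff_group I)"
  by (rule groupI) auto

text \<open>Extension of an independent set: the image of the smaller model has too few elements to
  be \<open>N\<close>, so a new basis vector can be sent outside it.\<close>

lemma symdiff_group_embedding:
  assumes "elementary_abelian 2 N" "finite I" "2 ^ card I \<le> order N"
  shows "\<exists>\<rho>\<in>hom (symdiff_group I) N. inj_on \<rho> (Pow I)"
  using assms(2,3)
proof (induction I rule: finite_induct)
  case empty
  interpret comm_group N using assms(1) by (simp add: elementary_abelian_def)
  have "(\<lambda>_. \<one>\<^bsub>N\<^esub>) \<in> hom (symdiff_group {}) N" by (simp add: hom_def)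
  then show ?case by (auto simp: inj_on_def)
next
  case (insert a I)
  interpret comm_group N using assms(1) by (simp add: elementary_abelian_def)
  have sq: "x \<otimes>\<^bsub>N\<^esub> x = \<one>\<^bsub>N\<^esub>" if "x \<in> carrier N" for x
    using assms(1) that by (simp add: elementary_abelian_def numeral_2_eq_2)
  have le: "2 ^ card I < order N"
  proof -
    have "(2::nat) ^ card I < 2 ^ card (insert a I)" using insert.hyps by simp
    also note insert.prems
    finally show ?thesis .
  qed
  then obtain \<rho> where \<rho>: "\<rho> \<in> hom (symdiff_group I) N" and inj: "inj_on \<rho> (Pow I)"
    using insert.IH by auto
  interpret \<rho>: group_hom "symdiff_group I" N \<rho>
    by (intro group_hom.intro group_hom_axioms.intro group_symdiff_group is_group \<rho>)
  have closed: "\<rho> A \<in> carrier N" if "A \<subseteq> I" for A using \<rho>.hom_closed[of A] that by simp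
  have mult: "\<rho> ((A - B) \<union> (B - A)) = \<rho> A \<otimes>\<^bsub>N\<^esub> \<rho> B" if "A \<subseteq> I" "B \<subseteq> I" for A B
    using \<rho>.hom_mult[of A B] that by simp
  have "card (\<rho> ` Pow I) = 2 ^ card I"
    using insert.hyps inj by (simp add: card_image card_Pow)
  then have "\<not> carrier N \<subseteq> \<rho> ` Pow I"
    using le insert.hyps card_mono[of "\<rho> ` Pow I" "carrier N"] by (auto simp: order_def)
  then obtain x where x: "x \<in> carrier N" "x \<notin> \<rho> ` Pow I" by blast
  \<comment> \<open>Sends the new basis vector \<open>a\<close> to \<open>x\<close> and agrees with
    \<open>\<rho>\<close> on the subsets of \<open>I\<close>.\<close>
  define \<sigma> where "\<sigma> A = (if a \<in> A then x else \<one>\<^bsub>N\<^esub>) \<otimes>\<^bsub>N\<^esub> \<rho> (A - {a})" for A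
  have sub: "A - {a} \<subseteq> I" if "A \<subseteq> insert a I" for A using that by blast
  have ne: "x \<otimes>\<^bsub>N\<^esub> \<rho> A \<noteq> \<rho> B" if A: "A \<subseteq> I" and B: "B \<subseteq> I" for A B
  proof
    assume eq: "x \<otimes>\<^bsub>N\<^esub> \<rho> A = \<rho> B"
    have "x = x \<otimes>\<^bsub>N\<^esub> \<rho> A \<otimes>\<^bsub>N\<^esub> \<rho> A" using x(1) closed[OF A] sq by (simp add: m_assoc)
    also have "\<dots> = \<rho> ((B - A) \<union> (A - B))" using mult[OF B A] by (simp add: eq)
    finally show False using x(2) A B by blast
  qed
  have "\<sigma> \<in> hom (symdiff_group (insert a I)) N"
  proof (rule homI; simp)
    fix A B assume A: "A \<subseteq> insert a I" and B: "B \<subseteq> insert a I"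
    note cl = closed[OF sub[OF A]] closed[OF sub[OF B]] x(1)
    show "\<sigma> A \<in> carrier N" using cl by (simp add: \<sigma>_def)
    have "(A - B \<union> (B - A)) - {a} = ((A - {a}) - (B - {a})) \<union> ((B - {a}) - (A - {a}))"
      by blast
    then have \<rho>_eq: "\<rho> ((A - B \<union> (B - A)) - {a}) = \<rho> (A - {a}) \<otimes>\<^bsub>N\<^esub> \<rho> (B - {a})"
      using mult[OF sub[OF A] sub[OF B]] by simp
    have xx: "x \<otimes>\<^bsub>N\<^esub> (x \<otimes>\<^bsub>N\<^esub> y) = y" if "y \<in> carrier N" for y
      using that x(1) sq by (simp add: m_assoc[symmetric])
    show "\<sigma> (A - B \<union> (B - A)) = \<sigma> A \<otimes>\<^bsub>N\<^esub> \<sigma> B"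
      unfolding \<sigma>_def \<rho>_eq using cl by (auto simp: m_ac xx sq)
  qed
  moreover have "inj_on \<sigma> (Pow (insert a I))"
  proof (rule inj_onI; simp)
    fix A B assume A: "A \<subseteq> insert a I" and B: "B \<subseteq> insert a I" and eq: "\<sigma> A = \<sigma> B"
    note cl = closed[OF sub[OF A]] closed[OF sub[OF B]] x(1)
    have "a \<in> A \<longleftrightarrow> a \<in> B"
      using eq ne[OF sub[OF A] sub[OF B]] ne[OF sub[OF B] sub[OF A]] cl
      by (auto simp: \<sigma>_def split: if_splits)
    moreover from this have "\<rho> (A - {a}) = \<rho> (B - {a})"
      using eq cl by (auto simp: \<sigma>_def split: if_splits)
    then have "A - {a} = B - {a}" using inj sub[OF A] sub[OF B] by (auto dest: inj_onD)
    ultimately show "A = B" by blast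
  qed
  ultimately show ?case by blast
qed

lemma symdiff_group_iso:
  assumes "elementary_abelian 2 N" "order N = 2 ^ n"
  shows "symdiff_group {..<n} \<cong> N"
proof -
  obtain \<rho> where \<rho>: "\<rho> \<in> hom (symdiff_group {..<n}) N" and inj: "inj_on \<rho> (Pow {..<n})"
    using symdiff_group_embedding[OF assms(1), of "{..<n}"] assms(2) by auto
  have "finite (carrier N)" using assms(2) by (metis card.infinite order_def power_not_zero zero_neq_numeral)
  moreover have "\<rho> ` Pow {..<n} \<subseteq> carrier N" using \<rho> by (auto simp: hom_def)
  moreover have "card (\<rho> ` Pow {..<n}) = card (carrier N)"
    using inj assms(2) by (simp add: card_image card_Pow order_def)
  ultimately have "\<rho> ` Pow {..<n} = carrier N" by (rule card_subset_eq)
  then have "\<rho> \<in> iso (symdiff_group {..<n}) N"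
    using \<rho> inj by (simp add: iso_def bij_betw_def)
  then show ?thesis by (rule is_isoI)
qed

lemma elementary_abelian_2_iso:
  assumes "elementary_abelian 2 M" "elementary_abelian 2 N" "order M = 2 ^ n" "order N = 2 ^ n"
  shows "M \<cong> N"
  using assms symdiff_group_iso group.iso_sym[OF group_symdiff_group] iso_trans by metis

section \<open>Powers of the natural module as elementary abelian groups\<close>

definition vec_group :: "(bit^'n) monoid"
  where "vec_group = \<lparr>carrier = UNIV, monoid.mult = (+), one = 0\<rparr>"

lemma vec_group_simps [simp]:
  "carrier vec_group = UNIV" "monoid.mult vec_group = (+)" "one vec_group = 0"
  by (simp_all add: vec_group_def)

lemma group_vec_group: "group vec_group"
  by (rule groupI) (auto simp: ac_simps intro: vec_add_self)

lemma elementary_abelian_vec_power: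
  "elementary_abelian 2 (product_group I (\<lambda>_. vec_group :: (bit^'n) monoid))" (is "elementary_abelian 2 ?W")
proof -
  interpret W: group ?W by (simp add: group_vec_group)
  have "comm_group ?W"
    by (rule W.group_comm_groupI) (auto simp: ac_simps)
  moreover have "w [^]\<^bsub>?W\<^esub> (2::nat) = \<one>\<^bsub>?W\<^esub>" if "w \<in> carrier ?W" for w
    using that by (auto simp: numeral_2_eq_2 PiE_iff fun_eq_iff extensional_def)
  ultimately show ?thesis by (simp add: elementary_abelian_def)
qed

lemma order_vec_power:
  "order (product_group {1..r} (\<lambda>_. vec_group :: (bit^3) monoid)) = 2 ^ (3 * r)"
proof -
  have "(UNIV :: bit set) = {0, 1}" by (auto intro: bit.exhaust)
  then have "CARD(bit) = 2" by (metis card_2_iff zero_neq_one)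
  then have "CARD(bit^3) = 8" by simp
  then show ?thesis by (simp add: order_def card_PiE power_mult)
qed

section \<open>Solubility of wreath products\<close>

lemma derived_product_group_subset:
  assumes K: "group K" and A: "A \<subseteq> carrier K"
  shows "derived (product_group I (\<lambda>_. K)) (I \<rightarrow>\<^sub>E A) \<subseteq> (I \<rightarrow>\<^sub>E derived K A)"
proof -
  interpret K: group K by fact
  interpret P: group "product_group I (\<lambda>_. K)" by (simp add: K)
  have sub: "subgroup (I \<rightarrow>\<^sub>E derived K A) (product_group I (\<lambda>_. K))"
    using K.derived_is_subgroup[OF A] by (simp add: PiE_subgroup_product_group K)
  show ?thesis
    unfolding derived_def[of "product_group I (\<lambda>_. K)"]
  proof (rule P.generate_subgroup_incl[OF _ sub], rule subsetI)
    fix c assume "c \<in> derived_set (product_group I (\<lambda>_. K)) (I \<rightarrow>\<^sub>E A)"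
    then obtain f g where f: "f \<in> I \<rightarrow>\<^sub>E A" and g: "g \<in> I \<rightarrow>\<^sub>E A"
      and c: "c = f \<otimes>\<^bsub>product_group I (\<lambda>_. K)\<^esub> g \<otimes>\<^bsub>product_group I (\<lambda>_. K)\<^esub>
        inv\<^bsub>product_group I (\<lambda>_. K)\<^esub> f \<otimes>\<^bsub>product_group I (\<lambda>_. K)\<^esub> inv\<^bsub>product_group I (\<lambda>_. K)\<^esub> g"
      by blast
    have "f \<in> (\<Pi>\<^sub>E i\<in>I. carrier K)" "g \<in> (\<Pi>\<^sub>E i\<in>I. carrier K)" using f g A by (auto simp: PiE_iff)
    then have "c = (\<lambda>i\<in>I. f i \<otimes>\<^bsub>K\<^esub> g i \<otimes>\<^bsub>K\<^esub> inv\<^bsub>K\<^esub> f i \<otimes>\<^bsub>K\<^esub> inv\<^bsub>K\<^esub> g i)"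
      unfolding c by (auto simp: K fun_eq_iff)
    moreover have "f i \<otimes>\<^bsub>K\<^esub> g i \<otimes>\<^bsub>K\<^esub> inv\<^bsub>K\<^esub> f i \<otimes>\<^bsub>K\<^esub> inv\<^bsub>K\<^esub> g i \<in> derived K A" if "i \<in> I" for i
      using that f g by (intro commutator_in_derived) (auto simp: PiE_iff)
    ultimately show "c \<in> I \<rightarrow>\<^sub>E derived K A" by simp
  qed
qed

text \<open>Commutators are formed coordinatewise, so the derived series of the power stays inside
  the power of the derived series.\<close>

lemma solvable_product_group:
  assumes K: "group K" and "solvable K"
  shows "solvable (product_group I (\<lambda>_. K))"
proof -
  interpret K: group K by fact
  interpret P: group "product_group I (\<lambda>_. K)" by (simp add: K)
  let ?P = "product_group I (\<lambda>_. K)"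
  obtain n where n: "(derived K ^^ n) (carrier K) = {\<one>\<^bsub>K\<^esub>}"
    using assms(2) K.solvable_iff_trivial_derived_seq by blast
  have "(derived ?P ^^ n) (carrier ?P) \<subseteq> (I \<rightarrow>\<^sub>E (derived K ^^ n) (carrier K))" for n
  proof (induction n)
    case (Suc n)
    have "(derived ?P ^^ Suc n) (carrier ?P) \<subseteq> derived ?P (I \<rightarrow>\<^sub>E (derived K ^^ n) (carrier K))"
      using P.mono_derived[OF Suc] by simp
    also have "\<dots> \<subseteq> (I \<rightarrow>\<^sub>E (derived K ^^ Suc n) (carrier K))"
      using derived_product_group_subset[OF K K.exp_of_derived_in_carrier[OF subset_refl]] by simp
    finally show ?case .
  qed simp
  from this[of n] have "(derived ?P ^^ n) (carrier ?P) \<subseteq> {\<one>\<^bsub>?P\<^esub>}"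
    unfolding n by (auto simp: PiE_iff fun_eq_iff extensional_def)
  moreover have "\<one>\<^bsub>?P\<^esub> \<in> (derived ?P ^^ n) (carrier ?P)"
    by (rule subgroup.one_closed[OF P.exp_of_derived_is_subgroup[OF P.subgroup_self]])
  ultimately have "(derived ?P ^^ n) (carrier ?P) = {\<one>\<^bsub>?P\<^esub>}" by blast
  then show ?thesis using P.solvable_iff_trivial_derived_seq by blast
qed

text \<open>An extension of the base group, a power of \<open>K\<close>, by
  \<open>H\<close>.\<close>

lemma solvable_wreath:
  assumes K: "group K" and H: "subgroup H (sym_group r)"
    and "solvable K" "solvable ((sym_group r)\<lparr>carrier := H\<rparr>)"
  shows "solvable (wreath K r H)"
proof (rule solvable_condition)
  let ?P = "product_group {1..r} (\<lambda>_. K)" and ?S = "(sym_group r)\<lparr>carrier := H\<rparr>"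
  have id: "id \<in> H" using subgroup.one_closed[OF H] by (simp add: sym_group_one)
  have W: "group (wreath K r H)" by (rule group_wreath[OF K H])
  have S: "group ?S" by (rule group.subgroup_imp_group[OF sym_group_is_group H])
  show "group_hom ?P (wreath K r H) (\<lambda>f. (f, id))"
    using W id K by (intro group_hom.intro group_hom_axioms.intro) (auto simp: hom_def fun_eq_iff)
  show "group_hom (wreath K r H) ?S snd"
    using W S by (intro group_hom.intro group_hom_axioms.intro) (auto simp: hom_def sym_group_mult)
  show "snd ` carrier (wreath K r H) = carrier ?S"
  proof -
    have "(\<lambda>i\<in>{1..r}. \<one>\<^bsub>K\<^esub>) \<in> {1..r} \<rightarrow>\<^sub>E carrier K" using K by (simp add: group.is_monoid)
    then have "({1..r} \<rightarrow>\<^sub>E carrier K) \<noteq> {}" by blast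
    then show ?thesis by (simp add: snd_image_times)
  qed
  show "kernel (wreath K r H) ?S snd \<subseteq> (\<lambda>f. (f, id)) ` carrier ?P"
    by (auto simp: kernel_def sym_group_one)
  show "solvable ?P" by (rule solvable_product_group[OF K assms(3)])
qed (fact assms(4))

text \<open>\<open>K\<close> embeds diagonally in the base group; there is a coordinate to read off
  because \<open>r \<ge> 1\<close>.\<close>

lemma solvable_wreath_imp_solvable:
  assumes K: "group K" and H: "subgroup H (sym_group r)" and r: "r \<ge> 1"
    and "solvable (wreath K r H)"
  shows "solvable K"
proof -
  interpret K: group K by fact
  have id: "id \<in> H" using subgroup.one_closed[OF H] by (simp add: sym_group_one)
  interpret group_hom K "wreath K r H" "\<lambda>a. (\<lambda>i\<in>{1..r}. a, id)"
    using group_wreath[OF K H] K id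
    by (intro group_hom.intro group_hom_axioms.intro) (auto simp: hom_def fun_eq_iff)
  have "inj_on (\<lambda>a. (\<lambda>i\<in>{1..r}. a, id :: nat \<Rightarrow> nat)) (carrier K)"
  proof (rule inj_onI)
    fix a b assume "(\<lambda>i\<in>{1..r}. a, id :: nat \<Rightarrow> nat) = (\<lambda>i\<in>{1..r}. b, id)"
    then have "(\<lambda>i\<in>{1..r}. a) 1 = (\<lambda>i\<in>{1..r}. b) 1" by simp
    then show "a = b" using r by simp
  qed
  then show ?thesis using inj_hom_imp_solvable assms(4) by blast
qed

section \<open>Preimages of subgroups and transport of crossed actions along isomorphisms\<close>

lemma (in group_hom) subgroup_preimage:
  assumes "subgroup M H"
  shows "subgroup {x \<in> carrier G. h x \<in> M} G"
proof (rule G.subgroupI)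
  interpret M: subgroup M H by fact
  have "\<one>\<^bsub>G\<^esub> \<in> {x \<in> carrier G. h x \<in> M}" by simp
  then show "{x \<in> carrier G. h x \<in> M} \<noteq> {}" by blast
qed (use assms subgroup.m_closed subgroup.m_inv_closed in auto)

context crossed_action
begin

lemma transport:
  assumes "group N'" and \<psi>: "\<psi> \<in> iso N N'"
  defines "\<psi>' \<equiv> inv_into (carrier N) \<psi>"
  shows "crossed_action N' K (\<lambda>x a. \<psi> (act x (\<psi>' a))) (\<lambda>x. \<psi> (coc x))"
proof -
  interpret N': group N' by fact
  have hom: "\<psi> \<in> hom N N'" and bij: "bij_betw \<psi> (carrier N) (carrier N')"
    using \<psi> by (auto simp: iso_def)
  have iso': "\<psi>' \<in> iso N' N" unfolding \<psi>'_def by (rule N.iso_set_sym[OF \<psi>])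
  then have hom': "\<psi>' \<in> hom N' N" by (simp add: iso_def)
  have cl: "\<psi> a \<in> carrier N'" if "a \<in> carrier N" for a
    using hom that by (auto simp: hom_def)
  have cl': "\<psi>' a \<in> carrier N" if "a \<in> carrier N'" for a
    using hom' that by (auto simp: hom_def)
  have inv: "\<psi>' (\<psi> a) = a" if "a \<in> carrier N" for a
    unfolding \<psi>'_def using bij that by (simp add: bij_betw_inv_into_left)
  have inv': "\<psi> (\<psi>' a) = a" if "a \<in> carrier N'" for a
    unfolding \<psi>'_def using bij that by (simp add: bij_betw_inv_into_right)
  show ?thesis
  proof
    fix x assume x: "x \<in> carrier K"
    have "\<psi> \<circ> (act x \<circ> \<psi>') \<in> hom N' N'"
      by (rule hom_compose[OF hom_compose[OF hom' act_hom[OF x]] hom])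
    then show "(\<lambda>a. \<psi> (act x (\<psi>' a))) \<in> hom N' N'" by (simp add: comp_def)
  next
    fix x y assume x: "x \<in> carrier K" "y \<in> carrier K"
      and eq: "\<And>a. a \<in> carrier N' \<Longrightarrow> \<psi> (act x (\<psi>' a)) = \<psi> (act y (\<psi>' a))"
    show "x = y"
    proof (rule act_faithful[OF x])
      fix a assume a: "a \<in> carrier N"
      have "\<psi>' (\<psi> (act x a)) = \<psi>' (\<psi> (act y a))" using eq[OF cl[OF a]] a by (simp add: inv)
      then show "act x a = act y a" using a x by (simp add: inv act_closed)
    qed
  next
    show "(\<lambda>x. \<psi> (coc x)) ` carrier K = carrier N'"
      unfolding image_image[symmetric] coc_surj by (rule bij_betw_imp_surj_on[OF bij])
  next
    fix x y assume "x \<in> carrier K" "y \<in> carrier K"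
    then show "\<psi> (coc (x \<otimes>\<^bsub>K\<^esub> y)) = \<psi> (coc x) \<otimes>\<^bsub>N'\<^esub> \<psi> (act x (\<psi>' (\<psi> (coc y))))"
      using hom by (simp add: coc_mult inv coc_closed act_closed hom_mult)
  qed (simp_all add: act_one act_mult inv inv' cl' act_closed)
qed

end

section \<open>The wreath product acting on its natural module\<close>

definition wreath_act :: "nat \<Rightarrow> (nat \<Rightarrow> bit^3^3) \<times> (nat \<Rightarrow> nat) \<Rightarrow> (nat \<Rightarrow> bit^3) \<Rightarrow> nat \<Rightarrow> bit^3"
  where "wreath_act r = (\<lambda>(f, h) w. \<lambda>i\<in>{1..r}. f i *v w (Hilbert_Choice.inv h i))"

text \<open>The permutation does not enter: the top group acts linearly and carries the zero
  cocycle.\<close>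

definition wreath_coc :: "nat \<Rightarrow> (nat \<Rightarrow> bit^3^3) \<times> (nat \<Rightarrow> nat) \<Rightarrow> nat \<Rightarrow> bit^3"
  where "wreath_coc r = (\<lambda>(f, h). \<lambda>i\<in>{1..r}. gl_coc (f i))"

abbreviation vec_power :: "nat \<Rightarrow> (nat \<Rightarrow> bit^3) monoid"
  where "vec_power r \<equiv> product_group {1..r} (\<lambda>_. vec_group)"

lemma wreath_act_in: "wreath_act r x w \<in> {1..r} \<rightarrow>\<^sub>E UNIV"
  by (auto simp: wreath_act_def split: prod.split)

lemma perm_inv_in: "h permutes {1..r} \<Longrightarrow> i \<in> {1..r} \<Longrightarrow> Hilbert_Choice.inv h i \<in> {1..r}"
  by (metis permutes_in_image permutes_inv)

lemma wreath_act_mult: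
  assumes "h permutes {1..r}" "k permutes {1..r}"
  shows "wreath_act r ((f, h) \<otimes>\<^bsub>wreath GL32 r H\<^esub> (g, k)) w = wreath_act r (f, h) (wreath_act r (g, k) w)"
  using assms perm_inv_in[OF assms(1)]
  by (auto simp: wreath_act_def fun_eq_iff o_inv_distrib permutes_bij matrix_vector_mul_assoc)

lemma wreath_coc_mult:
  assumes "h permutes {1..r}" "f \<in> {1..r} \<rightarrow>\<^sub>E carrier GL32" "g \<in> {1..r} \<rightarrow>\<^sub>E carrier GL32"
  shows "wreath_coc r ((f, h) \<otimes>\<^bsub>wreath GL32 r H\<^esub> (g, k)) =
    wreath_coc r (f, h) \<otimes>\<^bsub>vec_power r\<^esub> wreath_act r (f, h) (wreath_coc r (g, k))"
proof -
  have "gl_coc (f i ** g (Hilbert_Choice.inv h i)) = gl_coc (f i) + f i *v gl_coc (g (Hilbert_Choice.inv h i))"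
    if "i \<in> {1..r}" for i
    using that assms(2,3) perm_inv_in[OF assms(1) that] by (intro gl_coc_mult) (auto simp: PiE_iff)
  then show ?thesis
    using perm_inv_in[OF assms(1)] by (auto simp: wreath_coc_def wreath_act_def fun_eq_iff)
qed

definition single_vec :: "nat \<Rightarrow> nat \<Rightarrow> bit^3 \<Rightarrow> nat \<Rightarrow> bit^3"
  where "single_vec r j v = (\<lambda>i\<in>{1..r}. if i = j then v else 0)"

lemma wreath_act_single_vec:
  assumes "h permutes {1..r}" "j \<in> {1..r}"
  shows "wreath_act r (f, h) (single_vec r j v) = single_vec r (h j) (f (h j) *v v)"
proof (rule ext)
  fix i
  have "Hilbert_Choice.inv h i = j \<longleftrightarrow> i = h j"
    using assms(1) by (metis permutes_inverses)
  then show "wreath_act r (f, h) (single_vec r j v) i = single_vec r (h j) (f (h j) *v v) i"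
    using perm_inv_in[OF assms(1), of i] by (auto simp: wreath_act_def single_vec_def)
qed

text \<open>Tested on vectors supported at one coordinate: the support of the image determines the
  permutation, its entry the matrix.\<close>

lemma wreath_act_faithful:
  assumes h: "h permutes {1..r}" and k: "k permutes {1..r}"
    and f: "f \<in> {1..r} \<rightarrow>\<^sub>E carrier GL32" and g: "g \<in> {1..r} \<rightarrow>\<^sub>E carrier GL32"
    and eq: "\<And>w. w \<in> {1..r} \<rightarrow>\<^sub>E UNIV \<Longrightarrow> wreath_act r (f, h) w = wreath_act r (g, k) w"
  shows "f = g" "h = k"
proof -
  have s: "single_vec r j v \<in> {1..r} \<rightarrow>\<^sub>E UNIV" for j v by (auto simp: single_vec_def)
  have eq': "single_vec r (h j) (f (h j) *v v) = single_vec r (k j) (g (k j) *v v)" if "j \<in> {1..r}" for j v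
    using eq[OF s, of j v] wreath_act_single_vec[OF h that, of f v] wreath_act_single_vec[OF k that, of g v] by simp
  have hin: "h j \<in> {1..r}" if "j \<in> {1..r}" for j using h that permutes_in_image by metis
  have hk: "h j = k j" if j: "j \<in> {1..r}" for j
  proof (rule ccontr)
    assume "h j \<noteq> k j"
    then have "f (h j) *v axis 1 1 = 0"
      using fun_cong[OF eq'[OF j, of "axis 1 1"], of "h j"] hin[OF j] by (simp add: single_vec_def)
    moreover have "invertible (f (h j))" using f hin[OF j] by auto
    ultimately show False by (simp add: invertible_mult_vec_eq_0_iff)
  qed
  show "h = k"
  proof
    \<comment> \<open>Outside \<open>{1..r}\<close> both permutations are the identity.\<close>
    show "h j = k j" for j
      using hk[of j] permutes_not_in[OF h, of j] permutes_not_in[OF k, of j] by metis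
  qed
  show "f = g"
  proof (rule PiE_ext[OF f g])
    fix i assume i: "i \<in> {1..r}"
    have j: "Hilbert_Choice.inv h i \<in> {1..r}" "h (Hilbert_Choice.inv h i) = i"
      using perm_inv_in[OF h i] permutes_inverses[OF h] by auto
    have "f i *v v = g i *v v" for v
      using fun_cong[OF eq'[OF j(1), of v], of i] j hk[OF j(1)] i by (simp add: single_vec_def)
    then show "f i = g i" using matrix_eq by blast
  qed
qed

lemma crossed_action_wreath:
  assumes H: "subgroup H (sym_group r)"
  shows "crossed_action (vec_power r) (wreath GL32 r H) (wreath_act r) (wreath_coc r)"
proof -
  have perm: "h permutes {1..r}" if "h \<in> H" for h
    using subgroup.subset[OF H] that sym_group_carrier by blast
  have id: "id \<in> H" using subgroup.one_closed[OF H] by (simp add: sym_group_one)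
  interpret W: group "wreath GL32 r H" by (rule group_wreath[OF group_GL H])
  interpret N: group "vec_power r" by (simp add: group_vec_group)
  show ?thesis
  proof
    fix x assume "x \<in> carrier (wreath GL32 r H)"
    then obtain f h where x: "x = (f, h)" "h permutes {1..r}" using perm by auto
    show "wreath_act r x \<in> hom (vec_power r) (vec_power r)"
      using perm_inv_in[OF x(2)]
      by (auto simp: x(1) hom_def wreath_act_def fun_eq_iff matrix_vector_right_distrib)
  next
    fix w assume "w \<in> carrier (vec_power r)"
    then show "wreath_act r \<one>\<^bsub>wreath GL32 r H\<^esub> w = w"
      by (auto simp: wreath_act_def fun_eq_iff PiE_iff extensional_def)
  next
    fix x y w assume "x \<in> carrier (wreath GL32 r H)" "y \<in> carrier (wreath GL32 r H)"
    then show "wreath_act r (x \<otimes>\<^bsub>wreath GL32 r H\<^esub> y) w = wreath_act r x (wreath_act r y w)"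
      using wreath_act_mult perm by (cases x; cases y) (auto simp del: wreath_simps(3))
  next
    fix x y assume "x \<in> carrier (wreath GL32 r H)" "y \<in> carrier (wreath GL32 r H)"
      and "\<And>w. w \<in> carrier (vec_power r) \<Longrightarrow> wreath_act r x w = wreath_act r y w"
    then show "x = y"
      using wreath_act_faithful[OF perm perm, of "snd x" "snd y" "fst x" "fst y"]
      by (cases x; cases y) auto
  next
    show "wreath_coc r ` carrier (wreath GL32 r H) = carrier (vec_power r)"
    proof (intro equalityI subsetI)
      fix w assume w: "w \<in> carrier (vec_power r)"
      obtain A where A: "\<And>v. invertible (A v) \<and> gl_coc (A v) = v" using gl_coc_surj by metis
      let ?x = "(\<lambda>i\<in>{1..r}. A (w i), id :: nat \<Rightarrow> nat)"
      have "w = wreath_coc r ?x"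
        using w A by (auto simp: wreath_coc_def fun_eq_iff PiE_iff extensional_def)
      moreover have "?x \<in> carrier (wreath GL32 r H)" using A id by auto
      ultimately show "w \<in> wreath_coc r ` carrier (wreath GL32 r H)" by (rule image_eqI)
    qed (auto simp: wreath_coc_def)
  next
    fix x y assume "x \<in> carrier (wreath GL32 r H)" "y \<in> carrier (wreath GL32 r H)"
    then show "wreath_coc r (x \<otimes>\<^bsub>wreath GL32 r H\<^esub> y) =
        wreath_coc r x \<otimes>\<^bsub>vec_power r\<^esub> wreath_act r x (wreath_coc r y)"
      using wreath_coc_mult perm by (cases x; cases y) (auto simp del: wreath_simps(3) mult_product_group GL_simps)
  qed
qed

lemma wreath_coc_eq_0_iff:
  "x \<in> carrier (wreath GL32 r H) \<and> wreath_coc r x = \<one>\<^bsub>vec_power r\<^esub> \<longleftrightarrow>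
     x \<in> ({1..r} \<rightarrow>\<^sub>E coc_kernel) \<times> H"
  by (cases x) (auto simp: wreath_coc_def coc_kernel_def PiE_iff fun_eq_iff; fastforce)

text \<open>The set is the image, under the identity map, of the wreath product of
  \<open>coc_kernel\<close>, taken as a group of its own, with \<open>H\<close>.\<close>

lemma solvable_point_stab:
  assumes H: "subgroup H (sym_group r)" and "solvable ((sym_group r)\<lparr>carrier := H\<rparr>)"
  shows "solvable_seq (wreath GL32 r H) (({1..r} \<rightarrow>\<^sub>E coc_kernel) \<times> H)"
proof -
  let ?S = "GL32\<lparr>carrier := coc_kernel\<rparr>"
  have S: "group ?S" by (rule GL.subgroup_imp_group[OF subgroup_coc_kernel])
  interpret i: group_hom ?S GL32 id by (rule GL.canonical_inj_is_hom[OF subgroup_coc_kernel])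
  have "solvable_seq ?S (carrier ?S)"
    by (rule i.solvable_img_imp_solvable[OF i.G.subgroup_self]) (use solvable_seq_coc_kernel in simp_all)
  then have "solvable ?S" by (simp only: solvable_def)
  then have sol: "solvable (wreath ?S r H)"
    by (rule solvable_wreath[OF S H _ assms(2)])
  interpret j: group_hom "wreath ?S r H" "wreath GL32 r H" id
    using group_wreath[OF S H] group_wreath[OF group_GL H]
    by (intro group_hom.intro group_hom_axioms.intro) (auto simp: hom_def PiE_iff extensional_def coc_kernel_def)
  show ?thesis
    using j.solvable_imp_solvable_img[OF sol[unfolded solvable_def]] by simp
qed

lemma wreath_irreducible:
  assumes H: "transitive_perm_group r H" and M: "subgroup M (vec_power r)"
    and inv: "\<And>x m. x \<in> ({1..r} \<rightarrow>\<^sub>E coc_kernel) \<times> H \<Longrightarrow> m \<in> M \<Longrightarrow> wreath_act r x m \<in> M"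
  shows "M = {\<one>\<^bsub>vec_power r\<^esub>} \<or> M = carrier (vec_power r)"
proof (cases "M \<subseteq> {\<one>\<^bsub>vec_power r\<^esub>}")
  case True
  then show ?thesis using subgroup.one_closed[OF M] by blast
next
  case False
  have Hs: "subgroup H (sym_group r)" using H by (simp add: transitive_perm_group_def)
  have perm: "h permutes {1..r}" if "h \<in> H" for h
    using subgroup.subset[OF Hs] that sym_group_carrier by blast
  have id: "id \<in> H" using subgroup.one_closed[OF Hs] by (simp add: sym_group_one)
  have one: "mat 1 \<in> coc_kernel" using subgroup.one_closed[OF subgroup_coc_kernel] by simp
  have add: "(\<lambda>i\<in>{1..r}. v i + w i) \<in> M" if "v \<in> M" "w \<in> M" for v w
    using subgroup.m_closed[OF M that] by simp
  from False obtain w where w: "w \<in> M" "w \<noteq> (\<lambda>i\<in>{1..r}. 0)" by auto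
  have wc: "w \<in> {1..r} \<rightarrow>\<^sub>E UNIV" using subgroup.mem_carrier[OF M w(1)] by simp
  have "\<exists>i\<in>{1..r}. w i \<noteq> 0"
  proof (rule ccontr)
    assume "\<not> ?thesis"
    then have "w = (\<lambda>i\<in>{1..r}. 0)"
      using wc by (auto simp: fun_eq_iff PiE_iff extensional_def simp del: bit_not_zero_iff)
    with w(2) show False by simp
  qed
  then obtain i where i: "i \<in> {1..r}" "w i \<noteq> 0" by blast
  \<comment> \<open>Avoiding \<open>w i\<close> as well as 0 keeps the difference
    \<open>u + w i\<close> nonzero; one of the first two basis vectors will do.\<close>
  obtain u :: "bit^3" where u: "u \<noteq> 0" "u \<noteq> w i"
  proof (cases "w i = axis 1 1")
    case True
    show ?thesis by (rule that[of "axis 2 1"]) (auto simp: True axis_eq_axis)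
  next
    case False
    show ?thesis by (rule that[of "axis 1 1"]) (use False in auto)
  qed
  obtain A where A: "A \<in> coc_kernel" "A *v w i = u" using coc_kernel_transitive[OF i(2) u(1)] by blast
  let ?f = "\<lambda>j\<in>{1..r}. if j = i then A else mat 1"
  have "wreath_act r (?f, id) w \<in> M"
    using A(1) one id w(1) by (intro inv) auto
  from add[OF this w(1)] have "(\<lambda>j\<in>{1..r}. wreath_act r (?f, id) w j + w j) \<in> M" .
  \<comment> \<open>Coordinates other than \<open>i\<close> were left alone and cancel in
    characteristic 2.\<close>
  also have "(\<lambda>j\<in>{1..r}. wreath_act r (?f, id) w j + w j) = single_vec r i (u + w i)"
    using A(2) by (auto simp: wreath_act_def single_vec_def fun_eq_iff)
  finally have si: "single_vec r i (u + w i) \<in> M" .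
  have ne: "u + w i \<noteq> 0" using u(2) by (metis add_0_right vec_add_self_left)
  have single_vec: "single_vec r j v \<in> M" if j: "j \<in> {1..r}" for j v
  proof -
    obtain h where h: "h \<in> H" "h i = j"
      using H i(1) j unfolding transitive_perm_group_def by blast
    have nz: "single_vec r j v \<in> M" if v: "v \<noteq> 0" for v
    proof -
      obtain B where B: "B \<in> coc_kernel" "B *v (u + w i) = v" using coc_kernel_transitive[OF ne v] by blast
      \<comment> \<open>The matrix is constant for convenience: only its value at
        \<open>h i = j\<close> meets a nonzero entry.\<close>
      have "wreath_act r (\<lambda>_\<in>{1..r}. B, h) (single_vec r i (u + w i)) \<in> M"
        using B h by (intro inv si) auto
      then show ?thesis
        using wreath_act_single_vec[OF perm[OF h(1)] i(1)] h(2) j B(2) by simp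
    qed
    show ?thesis
    proof (cases "v = 0")
      case True
      have "single_vec r j v = (\<lambda>i\<in>{1..r}. 0)" by (auto simp: single_vec_def True)
      then show ?thesis using subgroup.one_closed[OF M] by simp
    qed (rule nz)
  qed
  have "carrier (vec_power r) \<subseteq> M"
  proof
    fix v assume "v \<in> carrier (vec_power r)"
    then have v: "v \<in> {1..r} \<rightarrow>\<^sub>E UNIV" by simp
    \<comment> \<open>\<open>v\<close> is assembled one coordinate at a time from vectors supported
      at a single coordinate.\<close>
    have "(\<lambda>i\<in>{1..r}. if i \<in> J then v i else 0) \<in> M" if "finite J" "J \<subseteq> {1..r}" for J
      using that
    proof (induction J rule: finite_induct)
      case empty
      then show ?case using subgroup.one_closed[OF M] by (simp add: restrict_def)
    next
      case (insert j J)
      have "(\<lambda>k\<in>{1..r}. single_vec r j (v j) k + (\<lambda>i\<in>{1..r}. if i \<in> J then v i else 0) k) \<in> M"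
        using insert by (intro add single_vec) auto
      also have "(\<lambda>k\<in>{1..r}. single_vec r j (v j) k + (\<lambda>i\<in>{1..r}. if i \<in> J then v i else 0) k)
          = (\<lambda>i\<in>{1..r}. if i \<in> insert j J then v i else 0)"
        using insert.hyps by (auto simp: single_vec_def fun_eq_iff)
      finally show ?case .
    qed
    from this[of "{1..r}"] have "(\<lambda>i\<in>{1..r}. if i \<in> {1..r} then v i else 0) \<in> M" by simp
    moreover have "(\<lambda>i\<in>{1..r}. if i \<in> {1..r} then v i else 0) = v"
      using v by (auto simp: fun_eq_iff PiE_iff extensional_def)
    ultimately show "v \<in> M" by simp
  qed
  then show ?thesis using subgroup.subset[OF M] by blast
qed

theorem theorem3p6:
  fixes r :: nat and H :: "(nat \<Rightarrow> nat) set" and N :: "('a, 'b) monoid_scheme"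
  assumes "r \<ge> 1"
    and "transitive_perm_group r H"
    and "solvable ((sym_group r)\<lparr>carrier := H\<rparr>)"
    and "elementary_abelian 2 N"
    and "order N = 2 ^ (3 * r)"
  shows "\<exists>G. transitive_hol_subgroup N G \<and>
    hol_subgroup N G \<cong> wreath GL32 r H \<and>
    \<not> (\<exists>M. admissible N G M \<and> M \<noteq> {\<one>\<^bsub>N\<^esub>} \<and> M \<noteq> carrier N) \<and>
    irreducible_solution G N"
proof -
  let ?W = "vec_power r" and ?K = "wreath GL32 r H"
  have H: "subgroup H (sym_group r)" using assms(2) by (simp add: transitive_perm_group_def)
  interpret N: comm_group N using assms(4) by (simp add: elementary_abelian_def)
  interpret W: crossed_action ?W ?K "wreath_act r" "wreath_coc r"
    by (rule crossed_action_wreath[OF H])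
  \<comment> \<open>Elementary abelian groups of equal order are isomorphic, so the action on the
    module can be carried over to \<open>N\<close>.\<close>
  obtain \<psi> where \<psi>: "\<psi> \<in> iso ?W N"
    using elementary_abelian_2_iso[OF elementary_abelian_vec_power assms(4) order_vec_power assms(5)]
    by (auto simp: is_iso_def)
  define \<psi>' where "\<psi>' = inv_into (carrier ?W) \<psi>"
  interpret C: crossed_action N ?K "\<lambda>x a. \<psi> (wreath_act r x (\<psi>' a))" "\<lambda>x. \<psi> (wreath_coc r x)"
    unfolding \<psi>'_def by (rule W.transport[OF N.is_group \<psi>])
  have \<psi>_hom: "\<psi> \<in> hom ?W N" and bij: "bij_betw \<psi> (carrier ?W) (carrier N)"
    using \<psi> by (auto simp: iso_def)
  interpret \<psi>: group_hom ?W N \<psi>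
    by (intro group_hom.intro group_hom_axioms.intro W.N.is_group N.is_group \<psi>_hom)
  \<comment> \<open>Transport therefore leaves the stabiliser of the identity unchanged.\<close>
  have "\<psi> w = \<one>\<^bsub>N\<^esub> \<longleftrightarrow> w = \<one>\<^bsub>?W\<^esub>" if "w \<in> carrier ?W" for w
    using bij that \<psi>.hom_one W.N.one_closed unfolding bij_betw_def by (metis inj_onD)
  then have stab: "x \<in> C.point_stab \<longleftrightarrow> x \<in> ({1..r} \<rightarrow>\<^sub>E coc_kernel) \<times> H" for x
    using wreath_coc_eq_0_iff[of x r H] W.coc_closed[of x] by blast
  then have stab_eq: "C.point_stab = ({1..r} \<rightarrow>\<^sub>E coc_kernel) \<times> H" by blast
  have trivial: "M = {\<one>\<^bsub>N\<^esub>} \<or> M = carrier N"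
    if M: "subgroup M N" and inv: "\<And>x m. x \<in> C.point_stab \<Longrightarrow> m \<in> M \<Longrightarrow> \<psi> (wreath_act r x (\<psi>' m)) \<in> M" for M
  proof -
    \<comment> \<open>Pulled back to the module, \<open>M\<close> becomes a subgroup to which
      \<open>wreath_irreducible\<close> applies.\<close>
    let ?M = "{w \<in> carrier ?W. \<psi> w \<in> M}"
    have sub: "subgroup ?M ?W"
      by (rule \<psi>.subgroup_preimage[OF M])
    have disj: "?M = {\<one>\<^bsub>?W\<^esub>} \<or> ?M = carrier ?W"
    proof (rule wreath_irreducible[OF assms(2) sub])
      fix x w assume x: "x \<in> ({1..r} \<rightarrow>\<^sub>E coc_kernel) \<times> H" and w: "w \<in> ?M"
      have "\<psi>' (\<psi> w) = w" unfolding \<psi>'_def using bij w by (simp add: bij_betw_inv_into_left)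
      then show "wreath_act r x w \<in> ?M"
        using inv[of x "\<psi> w"] x w stab wreath_act_in by auto
    qed
    have img: "\<psi> ` ?M = M"
    proof (intro equalityI subsetI)
      fix m assume m: "m \<in> M"
      then have "m \<in> \<psi> ` carrier ?W"
        using subgroup.mem_carrier[OF M] bij_betw_imp_surj_on[OF bij] by simp
      then obtain w where "w \<in> carrier ?W" "m = \<psi> w" by (rule imageE)
      with m show "m \<in> \<psi> ` ?M" by (intro image_eqI[of _ _ w]) simp_all
    qed auto
    show ?thesis
      using disj
    proof
      assume M1: "?M = {\<one>\<^bsub>?W\<^esub>}"
      show ?thesis using img unfolding M1 image_insert image_empty \<psi>.hom_one by blast
    next
      assume MW: "?M = carrier ?W"
      show ?thesis using img unfolding MW bij_betw_imp_surj_on[OF bij] by blast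
    qed
  qed
  have not_solvable: "\<not> solvable (hol_subgroup N C.hol_image)"
  proof
    assume sol: "solvable (hol_subgroup N C.hol_image)"
    interpret h: group_hom ?K "hol_subgroup N C.hol_image" C.hol_elem
      using C.hol_elem_hom C.hol.H.subgroup_imp_group[OF C.hol_image_subgroup]
      by (intro group_hom.intro group_hom_axioms.intro W.K.is_group) (auto simp: hom_def C.hol_image_def)
    \<comment> \<open>Solubility would descend along the embedding of the wreath product and then to
      the diagonal copy of \<open>GL32\<close>.\<close>
    have "solvable ?K" by (rule h.inj_hom_imp_solvable[OF C.hol_elem_inj sol])
    then show False
      using solvable_wreath_imp_solvable[OF group_GL H assms(1)] not_solvable_GL32 by blast
  qed
  have "(derived N ^^ 1) (carrier N) = {\<one>\<^bsub>N\<^esub>}"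
    using N.derived_eq_singleton[of "carrier N"] by simp
  then have "solvable N" using N.solvable_iff_trivial_derived_seq by blast
  moreover have "solvable (hol_subgroup N (stabilizer (hol_subgroup N C.hol_image) (hol_act N) a))"
    if "a \<in> carrier N" for a
    using C.solvable_stabilizer[OF _ that] solvable_point_stab[OF H assms(3)] stab_eq by simp
  moreover have "M = {\<one>\<^bsub>N\<^esub>} \<or> M = carrier N" if "invariant N C.hol_image M" for M
    using trivial[of M] C.invariant_imp_stab_invariant[OF that] that by (simp add: invariant_def)
  ultimately have "irreducible_solution C.hol_image N"
    unfolding irreducible_solution_def
    using N.is_group C.transitive_hol_image not_solvable by blast
  moreover have "M = {\<one>\<^bsub>N\<^esub>} \<or> M = carrier N" if "admissible N C.hol_image M" for M
    using trivial[of M] C.admissible_imp_stab_invariant[OF that] that by (simp add: admissible_def)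
  ultimately show ?thesis
    using C.transitive_hol_image C.hol_image_iso by blast
qed

end
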